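(* Let $U$ be a unitary operator on a Hilbert space $\mathcal{H}$ and suppose that the dynamics induced by $U$ on $\mathcal{H}$ is almost periodic, i.e. $\mathcal{H}$ is generated by the eigenvectors of $U$. Then for each pair-partition $\alpha:\{1,2,3,4\}\to\{1,2\}$ of four elements and every $\{A,B,C\}\subset\mathcal{B}(\mathcal{H})$, the limit in the weak operator topology, as $N\to\infty$, of $$\frac{1}{N^{2}}\sum_{n_1,n_2=0}^{N-1}U^{n_{\alpha(1)}}AU^{n_{\alpha(2)}}BU^{n_{\alpha(3)}}CU^{n_{\alpha(4)}}$$ exists and is equal to $S_{\alpha;A,B,C}$.
   Context: $\mathcal{B}(\mathcal{H})$ denotes the bounded operators on the (complex) Hilbert space $\mathcal{H}$. "$\mathcal{H}$ is generated by the eigenvectors of $U$" means that the closed linear span of the eigenvectors of $U$ is $\mathcal{H}$. A pair-partition $\alpha:\{1,2,3,4\}\to\{1,2\}$ is a surjective map each of whose preimages $\alpha^{-1}(\{1\})$, $\alpha^{-1}(\{2\})$ has exactly two elements. Let $\mathbb{T}$ be the unit circle, $\sigma_{\mathrm{pp}}(U)=\{z\in\mathbb{T} : z \text{ is an eigenvalue of } U\}$, and $\sigma_{\mathrm{pp}}^{\mathrm{a}}(U)=\{z\in\sigma_{\mathrm{pp}}(U) : zw=1\text{ for some }w\in\sigma_{\mathrm{pp}}(U)\}$. For $z\in\sigma_{\mathrm{pp}}(U)$, $E_z$ is the orthogonal projection onto the eigenspace of $U$ for the eigenvalue $z$. For a finite set $F\subset\sigma_{\mathrm{pp}}^{\mathrm{a}}(U)$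 and $A,B,C\in\mathcal{B}(\mathcal{H})$ put $$S^{F}_{\alpha;A,B,C}:=\sum_{z_1,z_2\in F}E_{z^{\#}_{\alpha(1)}}AE_{z^{\#}_{\alpha(2)}}BE_{z^{\#}_{\alpha(3)}}CE_{z^{\#}_{\alpha(4)}},$$ where, if $\alpha^{-1}(\{j\})=\{p<q\}$, then $z^{\#}_{\alpha(p)}=z_j$ and $z^{\#}_{\alpha(q)}=\bar z_j$. (For example, for $\alpha=\{1,2,1,2\}$ this is $\sum_{z,w\in F}E_zAE_wBE_{\bar z}CE_{\bar w}$.) The operator $S_{\alpha;A,B,C}$ is the limit in the weak operator topology (which exists) of the net $S^{F}_{\alpha;A,B,C}$, indexed by the finite subsets $F$ of $\sigma_{\mathrm{pp}}^{\mathrm{a}}(U)$ directed by inclusion. *)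

theory Defs
  imports "HOL-Analysis.Analysis"
begin

text \<open>
  Complex inner product spaces. Every such space is a real inner product space under the real part
  of its inner product; building on \<^class>\<open>real_inner\<close> fixes the norm, the topology and the real
  scalar multiplication, and contributes positive definiteness. The inner product is linear in its
  second argument.
\<close>

class complex_inner = real_inner +
  fixes scaleC :: "complex \<Rightarrow> 'a \<Rightarrow> 'a"  (infixr \<open>*\<^sub>C\<close> 75)
    and cinner :: "'a \<Rightarrow> 'a \<Rightarrow> complex"
  assumes scaleC_add_right: "c *\<^sub>C (x + y) = c *\<^sub>C x + c *\<^sub>C y"
    and scaleC_add_left: "(c + d) *\<^sub>C x = c *\<^sub>C x + d *\<^sub>C x"
    and scaleC_scaleC: "c *\<^sub>C d *\<^sub>C x = (c * d) *\<^sub>C x"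
    and scaleC_of_real: "complex_of_real r *\<^sub>C x = r *\<^sub>R x"
    and cinner_commute: "cinner x y = cnj (cinner y x)"
    and cinner_add_right: "cinner x (y + z) = cinner x y + cinner x z"
    and cinner_scaleC_right: "cinner x (c *\<^sub>C y) = c * cinner x y"
    and inner_eq_Re_cinner: "inner x y = Re (cinner x y)"

class complex_hilbert_space = complex_inner + banach

instantiation complex :: complex_hilbert_space
begin

definition "scaleC_complex (c::complex) x = c * x"
definition "cinner_complex (x::complex) y = cnj x * y"

instance
  by standard (auto simp: scaleC_complex_def cinner_complex_def inner_complex_def
      ring_distribs scaleR_conv_of_real)

end

global_interpretation complex_vector:
  vector_space "scaleC :: complex \<Rightarrow> 'a \<Rightarrow> 'a::complex_inner"
proof
  show "1 *\<^sub>C x = x" for x :: 'a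
    using scaleC_of_real[of 1 x] by simp
qed (simp_all add: scaleC_add_right scaleC_add_left scaleC_scaleC)

definition bounded_clinear :: "('a::complex_inner \<Rightarrow> 'b::complex_inner) \<Rightarrow> bool" where
  "bounded_clinear T \<longleftrightarrow>
     Vector_Spaces.linear scaleC scaleC T \<and> (\<exists>K. \<forall>x. norm (T x) \<le> norm x * K)"

definition is_adjoint :: "('a::complex_inner \<Rightarrow> 'a) \<Rightarrow> ('a \<Rightarrow> 'a) \<Rightarrow> bool" where
  "is_adjoint V U \<longleftrightarrow> (\<forall>x y. cinner (V x) y = cinner x (U y))"

definition unitary_op :: "('a::complex_inner \<Rightarrow> 'a) \<Rightarrow> bool" where
  "unitary_op U \<longleftrightarrow> bounded_clinear U \<and>
     (\<exists>V. bounded_clinear V \<and> is_adjoint V U \<and> V \<circ> U = id \<and> U \<circ> V = id)"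

text \<open>
  The weak operator topology on the bounded operators: the coarsest topology for which all the
  functionals \<open>T \<mapsto> cinner x (T y)\<close> are continuous.
\<close>

definition weak_operator_topology :: "('a::complex_inner \<Rightarrow> 'a) topology" where
  "weak_operator_topology =
     pullback_topology {T. bounded_clinear T} (\<lambda>T (x, y). cinner x (T y)) euclidean"

lemma limitin_weak_operator_topology:
  fixes T :: "'i \<Rightarrow> 'a::complex_inner \<Rightarrow> 'a"
  shows "limitin weak_operator_topology T L F \<longleftrightarrow>
    bounded_clinear L \<and> (\<forall>\<^sub>F i in F. bounded_clinear (T i)) \<and>
    (\<forall>x y. ((\<lambda>i. cinner x (T i y)) \<longlongrightarrow> cinner x (L y)) F)"
proof -
  let ?f = "\<lambda>(T :: 'a \<Rightarrow> 'a) (x, y). cinner x (T y)"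
  have "limitin weak_operator_topology T L F \<longleftrightarrow>
    bounded_clinear L \<and> (\<forall>\<^sub>F i in F. bounded_clinear (T i)) \<and>
    limitin euclidean (\<lambda>i. ?f (T i)) (?f L) F"
  proof
    assume lim: "limitin weak_operator_topology T L F"
    have op: "openin weak_operator_topology (?f -` W \<inter> {T. bounded_clinear T})" if "open W" for W
      unfolding weak_operator_topology_def openin_pullback_topology using that open_openin by blast
    have L: "bounded_clinear L"
      using lim by (simp add: limitin_def weak_operator_topology_def topspace_pullback_topology)
    have ev: "\<forall>\<^sub>F i in F. ?f (T i) \<in> W \<and> bounded_clinear (T i)" if "open W" "?f L \<in> W" for W
    proof -
      have "L \<in> ?f -` W \<inter> {T. bounded_clinear T}"
        using that(2) L by blast
      then have "\<forall>\<^sub>F i in F. T i \<in> ?f -` W \<inter> {T. bounded_clinear T}"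
        using lim op[OF that(1)] unfolding limitin_def by blast
      then show ?thesis
        by (rule eventually_mono) blast
    qed
    have "\<forall>\<^sub>F i in F. bounded_clinear (T i)"
      using ev[OF open_UNIV UNIV_I] by (rule eventually_mono) blast
    moreover have "limitin euclidean (\<lambda>i. ?f (T i)) (?f L) F"
      unfolding limitin_def topspace_euclidean open_openin[symmetric]
      using ev by (blast intro: eventually_mono)
    ultimately show "bounded_clinear L \<and> (\<forall>\<^sub>F i in F. bounded_clinear (T i)) \<and>
        limitin euclidean (\<lambda>i. ?f (T i)) (?f L) F"
      using L by blast
  next
    assume "bounded_clinear L \<and> (\<forall>\<^sub>F i in F. bounded_clinear (T i)) \<and>
        limitin euclidean (\<lambda>i. ?f (T i)) (?f L) F"
    then show "limitin weak_operator_topology T L F"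
      by (auto simp: limitin_def weak_operator_topology_def topspace_pullback_topology
          openin_pullback_topology eventually_conj_iff)
  qed
  also have "limitin euclidean (\<lambda>i. ?f (T i)) (?f L) F \<longleftrightarrow>
      (\<forall>x y. ((\<lambda>i. cinner x (T i y)) \<longlongrightarrow> cinner x (L y)) F)"
    by (simp add: euclidean_product_topology [symmetric] limitin_componentwise)
  finally show ?thesis .
qed

definition eigenspace :: "('a::complex_inner \<Rightarrow> 'a) \<Rightarrow> complex \<Rightarrow> 'a set" where
  "eigenspace U z = {x. U x = z *\<^sub>C x}"

definition eigenvectors :: "('a::complex_inner \<Rightarrow> 'a) \<Rightarrow> 'a set" where
  "eigenvectors U = {x. x \<noteq> 0 \<and> (\<exists>z. x \<in> eigenspace U z)}"

definition almost_periodic :: "('a::complex_inner \<Rightarrow> 'a) \<Rightarrow> bool" where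
  "almost_periodic U \<longleftrightarrow> closure (complex_vector.span (eigenvectors U)) = UNIV"

definition sigma_pp :: "('a::complex_inner \<Rightarrow> 'a) \<Rightarrow> complex set" where
  "sigma_pp U = {z. norm z = 1 \<and> (\<exists>x. x \<noteq> 0 \<and> x \<in> eigenspace U z)}"

definition sigma_pp_a :: "('a::complex_inner \<Rightarrow> 'a) \<Rightarrow> complex set" where
  "sigma_pp_a U = {z \<in> sigma_pp U. \<exists>w \<in> sigma_pp U. z * w = 1}"

text \<open>Well defined for closed subspaces of a Hilbert space.\<close>

definition orthogonal_projection :: "'a::complex_inner set \<Rightarrow> 'a \<Rightarrow> 'a" where
  "orthogonal_projection M x = (THE y. y \<in> M \<and> (\<forall>m \<in> M. cinner m (x - y) = 0))"

definition eigenprojection :: "('a::complex_inner \<Rightarrow> 'a) \<Rightarrow> complex \<Rightarrow> 'a \<Rightarrow> 'a" where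
  "eigenprojection U z = orthogonal_projection (eigenspace U z)"

text \<open>Maps from \<open>{1,2,3,4}\<close> are functions on \<^typ>\<open>nat\<close> whose values elsewhere are never used.\<close>

definition pair_partition :: "(nat \<Rightarrow> nat) \<Rightarrow> bool" where
  "pair_partition \<alpha> \<longleftrightarrow> \<alpha> ` {1..4} = {1, 2} \<and>
     (\<forall>j \<in> {1, 2}. card {p \<in> {1..4}. \<alpha> p = j} = 2)"

definition choose2 :: "'b \<Rightarrow> 'b \<Rightarrow> nat \<Rightarrow> 'b" where
  "choose2 a b j = (if j = 1 then a else b)"

text \<open>
  \<open>sharp \<alpha> z p\<close> is the spectral parameter at position \<open>p\<close>: \<open>z (\<alpha> p)\<close> if \<open>p\<close> is the first of the two
  positions in its block, its conjugate if \<open>p\<close> is the second.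
\<close>

definition sharp :: "(nat \<Rightarrow> nat) \<Rightarrow> (nat \<Rightarrow> complex) \<Rightarrow> nat \<Rightarrow> complex" where
  "sharp \<alpha> z p =
     (if p = Min {q \<in> {1..4}. \<alpha> q = \<alpha> p} then z (\<alpha> p) else cnj (z (\<alpha> p)))"

definition S_partial ::
  "('a::complex_inner \<Rightarrow> 'a) \<Rightarrow> (nat \<Rightarrow> nat) \<Rightarrow> ('a \<Rightarrow> 'a) \<Rightarrow> ('a \<Rightarrow> 'a) \<Rightarrow> ('a \<Rightarrow> 'a) \<Rightarrow>
    complex set \<Rightarrow> 'a \<Rightarrow> 'a" where
  "S_partial U \<alpha> A B C F = (\<lambda>x. \<Sum>z\<^sub>1\<in>F. \<Sum>z\<^sub>2\<in>F.
     let E = (\<lambda>p. eigenprojection U (sharp \<alpha> (choose2 z\<^sub>1 z\<^sub>2) p))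
     in (E 1 \<circ> A \<circ> E 2 \<circ> B \<circ> E 3 \<circ> C \<circ> E 4) x)"

definition S_op ::
  "('a::complex_inner \<Rightarrow> 'a) \<Rightarrow> (nat \<Rightarrow> nat) \<Rightarrow> ('a \<Rightarrow> 'a) \<Rightarrow> ('a \<Rightarrow> 'a) \<Rightarrow> ('a \<Rightarrow> 'a) \<Rightarrow>
    'a \<Rightarrow> 'a" where
  "S_op U \<alpha> A B C = (THE S.
     limitin weak_operator_topology (S_partial U \<alpha> A B C) S (finite_subsets_at_top (sigma_pp_a U)))"

definition entangled_average ::
  "('a::complex_inner \<Rightarrow> 'a) \<Rightarrow> (nat \<Rightarrow> nat) \<Rightarrow> ('a \<Rightarrow> 'a) \<Rightarrow> ('a \<Rightarrow> 'a) \<Rightarrow> ('a \<Rightarrow> 'a) \<Rightarrow>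
    nat \<Rightarrow> 'a \<Rightarrow> 'a" where
  "entangled_average U \<alpha> A B C N = (\<lambda>x. (1 / (real N)\<^sup>2) *\<^sub>R (\<Sum>n\<^sub>1<N. \<Sum>n\<^sub>2<N.
     let P = (\<lambda>p. U ^^ choose2 n\<^sub>1 n\<^sub>2 (\<alpha> p))
     in (P 1 \<circ> A \<circ> P 2 \<circ> B \<circ> P 3 \<circ> C \<circ> P 4) x))"

end

theory Submission
  imports Defs
begin

text \<open>
  Both nets converge even strongly, to the same operator. On an eigenvector \<open>v\<close> with eigenvalue \<open>w\<close>,
  the averages of \<open>U\<^sup>n D U\<^sup>n\<close> become the ergodic averages of \<open>w\<^sup>n U\<^sup>n\<close> applied to \<open>D v\<close>, which
  converge to the projection of \<open>D v\<close> onto the eigenspace of \<open>cnj w\<close>; the finite sums of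
  \<open>E\<^sub>z D E\<^bsub>cnj z\<^esub>\<close> reduce to that same projection as soon as \<open>cnj w\<close> is among the indices. Uniform
  bounds and density of the span of the eigenvectors extend this to all vectors. The partitions
  \<open>1122\<close> and \<open>1221\<close> are compositions of such diagonal operations, and so is \<open>1212\<close> once it is
  applied to an eigenvector. For the finite spectral sums of the crossed partition \<open>1212\<close> the
  uniform bound comes from iterating Pythagoras and Bessel's inequality.
\<close>

section \<open>Operators with an explicit norm bound\<close>

text \<open>The bound is a parameter, not an existential as in \<open>bounded_clinear\<close>,
  because density arguments need one constant for a whole family of operators.
  \<open>0 \<le> K\<close> is demanded since on the zero space it would not follow from the
  inequality.\<close>

definition clinear_norm_le :: "real \<Rightarrow> ('a::complex_inner \<Rightarrow> 'b::complex_inner) \<Rightarrow> bool" where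
  "clinear_norm_le K T \<longleftrightarrow> (\<forall>x y. T (x + y) = T x + T y) \<and> (\<forall>c x. T (c *\<^sub>C x) = c *\<^sub>C T x) \<and>
     0 \<le> K \<and> (\<forall>x. norm (T x) \<le> K * norm x)"

lemma clinear_norm_leI:
  assumes "\<And>x y. T (x + y) = T x + T y" "\<And>c x. T (c *\<^sub>C x) = c *\<^sub>C T x"
    "0 \<le> K" "\<And>x. norm (T x) \<le> K * norm x"
  shows "clinear_norm_le K T"
  using assms by (auto simp: clinear_norm_le_def)

lemma clinear_norm_leD:
  assumes "clinear_norm_le K T"
  shows "T (x + y) = T x + T y" "T (c *\<^sub>C x) = c *\<^sub>C T x" "0 \<le> K" "norm (T x) \<le> K * norm x"
  using assms by (auto simp: clinear_norm_le_def)

lemma clinear_norm_le_zero: "clinear_norm_le K T \<Longrightarrow> T 0 = 0"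
  using clinear_norm_leD(1)[of K T 0 0] by simp

lemma clinear_norm_le_scaleR:
  assumes "clinear_norm_le K T" shows "T (r *\<^sub>R x) = r *\<^sub>R T x"
  using clinear_norm_leD(2)[OF assms, of "of_real r"] by (simp add: scaleC_of_real)

lemma clinear_norm_le_diff:
  assumes "clinear_norm_le K T" shows "T (x - y) = T x - T y"
proof -
  have "T ((x - y) + y) = T (x - y) + T y" by (rule clinear_norm_leD(1)[OF assms])
  then show ?thesis by simp
qed

lemma clinear_norm_le_sum:
  assumes "clinear_norm_le K T" shows "T (\<Sum>i\<in>I. f i) = (\<Sum>i\<in>I. T (f i))"
  by (induction I rule: infinite_finite_induct)
    (simp_all add: clinear_norm_le_zero[OF assms] clinear_norm_leD(1)[OF assms])

lemma clinear_norm_le_bounded_linear: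
  assumes "clinear_norm_le K T" shows "bounded_linear T"
  using clinear_norm_leD[OF assms] clinear_norm_le_scaleR[OF assms]
  by (intro bounded_linear_intro[of T K]) (simp_all add: mult.commute)

lemmas clinear_norm_le_tendsto = bounded_linear.tendsto[OF clinear_norm_le_bounded_linear]

lemma bounded_clinear_iff: "bounded_clinear T \<longleftrightarrow> (\<exists>K. clinear_norm_le K T)"
proof
  assume "bounded_clinear T"
  then obtain K where l: "Vector_Spaces.linear scaleC scaleC T" and K: "\<And>x. norm (T x) \<le> norm x * K"
    unfolding bounded_clinear_def by blast
  \<comment> \<open>On the zero space the given constant may be negative, hence the absolute
    value.\<close>
  have "norm (T x) \<le> \<bar>K\<bar> * norm x" for x
  proof -
    have "norm (T x) \<le> norm x * K" by (rule K)
    also have "\<dots> \<le> \<bar>K\<bar> * norm x" by (simp add: mult.commute mult_right_mono)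
    finally show ?thesis .
  qed
  with l have "clinear_norm_le \<bar>K\<bar> T"
    by (intro clinear_norm_leI) (auto simp: Vector_Spaces.linear_iff)
  then show "\<exists>K. clinear_norm_le K T" ..
next
  assume "\<exists>K. clinear_norm_le K T"
  then obtain K where K: "clinear_norm_le K T" ..
  have "Vector_Spaces.linear scaleC scaleC T"
    unfolding Vector_Spaces.linear_iff
    using clinear_norm_leD[OF K] by (simp add: complex_vector.vector_space_axioms)
  moreover have "norm (T x) \<le> norm x * K" for x
    using clinear_norm_leD(4)[OF K, of x] by (simp add: mult.commute)
  ultimately show "bounded_clinear T"
    unfolding bounded_clinear_def by blast
qed

lemma clinear_norm_le_comp:
  assumes "clinear_norm_le K S" "clinear_norm_le L T"
  shows "clinear_norm_le (K * L) (\<lambda>x. S (T x))"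
proof (rule clinear_norm_leI)
  fix x
  have "norm (S (T x)) \<le> K * norm (T x)" by (rule clinear_norm_leD(4)[OF assms(1)])
  also have "\<dots> \<le> K * (L * norm x)"
    using clinear_norm_leD[OF assms(1)] clinear_norm_leD[OF assms(2)] by (intro mult_left_mono)
  finally show "norm (S (T x)) \<le> K * L * norm x" by (simp add: mult.assoc)
qed (use clinear_norm_leD[OF assms(1)] clinear_norm_leD[OF assms(2)] in simp_all)

lemma clinear_norm_le_average:
  assumes "0 \<le> K" "\<And>n. n < N \<Longrightarrow> clinear_norm_le K (T n)"
  shows "clinear_norm_le K (\<lambda>x. (1 / real N) *\<^sub>R (\<Sum>n<N. T n x))"
proof (rule clinear_norm_leI)
  fix x y :: 'a and c
  show "(1 / real N) *\<^sub>R (\<Sum>n<N. T n (x + y)) =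
      (1 / real N) *\<^sub>R (\<Sum>n<N. T n x) + (1 / real N) *\<^sub>R (\<Sum>n<N. T n y)"
    using clinear_norm_leD(1)[OF assms(2)] by (simp add: sum.distrib scaleR_add_right)
  show "(1 / real N) *\<^sub>R (\<Sum>n<N. T n (c *\<^sub>C x)) = c *\<^sub>C (1 / real N) *\<^sub>R (\<Sum>n<N. T n x)"
    using clinear_norm_leD(2)[OF assms(2)]
    by (simp add: complex_vector.scale_sum_right scaleC_of_real[symmetric] scaleC_scaleC mult.commute)
  have "norm (\<Sum>n<N. T n x) \<le> (\<Sum>n<N. K * norm x)"
    using clinear_norm_leD(4)[OF assms(2)] by (intro sum_norm_le) auto
  \<comment> \<open>For \<open>N = 0\<close> the convention \<open>1 / 0 = 0\<close> makes the
    average vanish, and the bound holds because \<open>0 \<le> K\<close>.\<close>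
  then show "norm ((1 / real N) *\<^sub>R (\<Sum>n<N. T n x)) \<le> K * norm x"
    using assms(1) by (cases "N = 0") (simp_all add: divide_simps mult.commute)
qed (rule assms(1))

lemma cinner_scaleC_left: "cinner (c *\<^sub>C x) y = cnj c * cinner x y"
  by (metis cinner_commute cinner_scaleC_right complex_cnj_mult)

lemma norm_scaleC: "norm (c *\<^sub>C x) = cmod c * norm x"
proof -
  have "cinner (c *\<^sub>C x) (c *\<^sub>C x) = of_real ((cmod c)\<^sup>2) * cinner x x"
    by (simp add: cinner_scaleC_left cinner_scaleC_right complex_norm_square[symmetric] mult.assoc
        mult.left_commute)
  then have "(norm (c *\<^sub>C x))\<^sup>2 = (cmod c * norm x)\<^sup>2"
    by (simp add: power2_norm_eq_inner inner_eq_Re_cinner power_mult_distrib)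
  then show ?thesis
    by (simp add: power2_eq_iff_nonneg)
qed

lemma clinear_norm_le_scaleC: "clinear_norm_le (cmod c) ((*\<^sub>C) c)"
  by (rule clinear_norm_leI)
    (simp_all add: scaleC_add_right scaleC_scaleC mult.commute norm_scaleC)

text \<open>With the complex numbers as a Hilbert space, continuity of this operator carries
  convergence of coefficients over to multiples of a fixed vector.\<close>

lemma clinear_norm_le_scaleC_left: "clinear_norm_le (norm u) (\<lambda>c. c *\<^sub>C u)"
  by (rule clinear_norm_leI)
    (simp_all add: scaleC_complex_def scaleC_add_left scaleC_scaleC norm_scaleC mult.commute)

text \<open>The real part is the real inner product, which is continuous; the imaginary part reduces
  to it after multiplying the second argument by \<open>\<i>\<close>.\<close>

lemma tendsto_cinner:
  assumes "(f \<longlongrightarrow> y) F" shows "((\<lambda>i. cinner x (f i)) \<longlongrightarrow> cinner x y) F"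
proof -
  have Im: "Im (cinner x y) = - inner x (\<i> *\<^sub>C y)" for y
    by (simp add: inner_eq_Re_cinner cinner_scaleC_right)
  have "((\<lambda>i. inner x (\<i> *\<^sub>C f i)) \<longlongrightarrow> inner x (\<i> *\<^sub>C y)) F"
    by (intro tendsto_intros clinear_norm_le_tendsto[OF clinear_norm_le_scaleC] assms)
  then show ?thesis
    unfolding tendsto_complex_iff Im
    by (auto simp: inner_eq_Re_cinner[symmetric] intro!: tendsto_intros assms)
qed

lemma cinner_eq_zero: "cinner x x = 0 \<Longrightarrow> x = 0"
  by (metis inner_eq_Re_cinner inner_eq_zero_iff zero_complex.sel(1))

section \<open>Strong convergence from a dense span\<close>

lemma strong_limit_if_dense:
  fixes T :: "'i \<Rightarrow> 'a::complex_inner \<Rightarrow> 'b::complex_inner"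
  assumes dense: "closure (complex_vector.span S) = UNIV"
    and T: "\<forall>\<^sub>F i in F. clinear_norm_le K (T i)" and L: "clinear_norm_le K' L"
    and S: "\<And>v. v \<in> S \<Longrightarrow> ((\<lambda>i. T i v) \<longlongrightarrow> L v) F"
  shows "((\<lambda>i. T i v) \<longlongrightarrow> L v) F"
proof -
  have span: "((\<lambda>i. T i u) \<longlongrightarrow> L u) F" if "u \<in> complex_vector.span S" for u
    using that
  proof (induction rule: complex_vector.span_induct_alt)
    case base
    from T have "\<forall>\<^sub>F i in F. T i 0 = L 0"
      by (rule eventually_mono) (simp add: clinear_norm_le_zero clinear_norm_le_zero[OF L])
    then show ?case by (rule tendsto_eventually)
  next
    case (step c x y)
    have "((\<lambda>i. c *\<^sub>C T i x + T i y) \<longlongrightarrow> c *\<^sub>C L x + L y) F"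
      by (intro tendsto_intros clinear_norm_le_tendsto[OF clinear_norm_le_scaleC] S step)
    moreover have "\<forall>\<^sub>F i in F. c *\<^sub>C T i x + T i y = T i (c *\<^sub>C x + y)"
      using T by (rule eventually_mono) (simp add: clinear_norm_leD)
    ultimately show ?case
      using clinear_norm_leD[OF L] by (simp add: tendsto_cong)
  qed
  show ?thesis
  proof (rule tendstoI)
    fix e :: real assume e: "e > 0"
    \<comment> \<open>The estimate has three terms: \<open>T i v\<close> to \<open>T i u\<close>,
      \<open>T i u\<close> to \<open>L u\<close>, and \<open>L u\<close> to \<open>L v\<close>, with
      \<open>u\<close> in the span close to \<open>v\<close>. \<open>M\<close> dominates both
      operator bounds; absolute values appear because the sign of \<open>K\<close> is known only
      eventually, and the added 1 makes \<open>M\<close> positive.\<close>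
    define M where "M = \<bar>K\<bar> + \<bar>K'\<bar> + 1"
    have M: "M > 0" "\<bar>K\<bar> \<le> M" "\<bar>K'\<bar> \<le> M" by (auto simp: M_def)
    have "v \<in> closure (complex_vector.span S)" using dense by simp
    then obtain u where u: "u \<in> complex_vector.span S" "dist u v < e / (3 * M)"
      using e M(1) unfolding closure_approachable
      by (metis divide_pos_pos mult_pos_pos zero_less_numeral)
    have uv: "M * norm (v - u) < e / 3"
      using u(2) M(1) by (simp add: dist_norm norm_minus_commute field_simps)
    have "\<forall>\<^sub>F i in F. dist (T i u) (L u) < e / 3"
      using e by (intro tendstoD[OF span[OF u(1)]]) simp
    with T show "\<forall>\<^sub>F i in F. dist (T i v) (L v) < e"
    proof eventually_elim
      case (elim i)
      have "norm (T i v - T i u) \<le> K * norm (v - u)"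
        using clinear_norm_leD(4)[OF elim(1), of "v - u"]
        by (simp add: clinear_norm_le_diff[OF elim(1)])
      also have "\<dots> \<le> M * norm (v - u)" using M by (intro mult_right_mono) auto
      finally have 1: "norm (T i v - T i u) < e / 3" using uv by simp
      have "norm (L v - L u) \<le> K' * norm (v - u)"
        using clinear_norm_leD(4)[OF L, of "v - u"] by (simp add: clinear_norm_le_diff[OF L])
      also have "\<dots> \<le> M * norm (v - u)" using M by (intro mult_right_mono) auto
      finally have 2: "norm (L v - L u) < e / 3" using uv by simp
      show ?case using 1 2 elim(2) unfolding dist_norm[symmetric]
        using dist_triangle[of "T i v" "L v" "T i u"] dist_triangle2[of "T i u" "L v" "L u"] by simp
    qed
  qed
qed

text \<open>The constant sequence \<open>T\<close> converges to \<open>L\<close> on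
  \<open>S\<close>, hence everywhere, and limits are unique.\<close>

lemma clinear_norm_le_eq_if_dense:
  assumes "closure (complex_vector.span S) = UNIV" "clinear_norm_le K T" "clinear_norm_le K' L"
    and "\<And>v. v \<in> S \<Longrightarrow> T v = L v"
  shows "T v = L v"
proof -
  have "((\<lambda>_::nat. T v) \<longlongrightarrow> L v) sequentially"
  proof (rule strong_limit_if_dense[where T = "\<lambda>_. T", OF assms(1) _ assms(3)])
    show "\<forall>\<^sub>F _ in sequentially. clinear_norm_le K T" using assms(2) by simp
    show "(\<lambda>_::nat. T v) \<longlonglongrightarrow> L v" if "v \<in> S" for v
      using assms(4)[OF that] by simp
  qed
  then show ?thesis by (simp add: tendsto_const_iff)
qed

lemma clinear_norm_le_limit:
  assumes T: "\<And>n::nat. clinear_norm_le K (T n)" and lim: "\<And>v. (\<lambda>n. T n v) \<longlonglongrightarrow> L v"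
  shows "clinear_norm_le K L"
proof (rule clinear_norm_leI)
  show "L (x + y) = L x + L y" for x y
    using tendsto_add[OF lim[of x] lim[of y]]
    by (intro LIMSEQ_unique[OF lim]) (simp add: clinear_norm_leD(1)[OF T])
  show "L (c *\<^sub>C x) = c *\<^sub>C L x" for c x
    using clinear_norm_le_tendsto[OF clinear_norm_le_scaleC lim[of x], of c]
    by (intro LIMSEQ_unique[OF lim]) (simp add: clinear_norm_leD(2)[OF T])
  show "0 \<le> K" by (rule clinear_norm_leD(3)[OF T])
  show "norm (L x) \<le> K * norm x" for x
    by (rule LIMSEQ_le_const2[OF tendsto_norm[OF lim]]) (use clinear_norm_leD(4)[OF T] in blast)
qed

text \<open>With no candidate limit at hand, the three-term estimate yields the Cauchy property
  instead, and completeness of the target space supplies the limit.\<close>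

lemma strong_limit_exists_if_dense:
  fixes T :: "nat \<Rightarrow> 'a::complex_inner \<Rightarrow> 'b::complex_hilbert_space"
  assumes dense: "closure (complex_vector.span S) = UNIV"
    and T: "\<And>n. clinear_norm_le K (T n)" and S: "\<And>v. v \<in> S \<Longrightarrow> convergent (\<lambda>n. T n v)"
  shows "(\<lambda>n. T n v) \<longlonglongrightarrow> lim (\<lambda>n. T n v)"
    and "clinear_norm_le K (\<lambda>v. lim (\<lambda>n. T n v))"
proof -
  have span: "convergent (\<lambda>n. T n u)" if "u \<in> complex_vector.span S" for u
    using that
  proof (induction rule: complex_vector.span_induct_alt)
    case base
    then show ?case using clinear_norm_le_zero[OF T] by (simp add: convergent_const)
  next
    case (step c x y)
    obtain l where "(\<lambda>n. T n x) \<longlonglongrightarrow> l"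
      using S[OF step(1)] by (auto simp: convergent_def)
    then have "convergent (\<lambda>n. c *\<^sub>C T n x)"
      by (rule convergentI[OF clinear_norm_le_tendsto[OF clinear_norm_le_scaleC]])
    then have "convergent (\<lambda>n. c *\<^sub>C T n x + T n y)"
      using step(2) by (rule convergent_add)
    then show ?case using clinear_norm_leD[OF T] by simp
  qed
  have K: "K \<ge> 0" by (rule clinear_norm_leD(3)[OF T])
  have "Cauchy (\<lambda>n. T n v)" for v
  proof (rule metric_CauchyI)
    fix e :: real assume e: "e > 0"
    have "v \<in> closure (complex_vector.span S)" using dense by simp
    \<comment> \<open>\<open>K\<close> may be zero, so \<open>K + 1\<close> serves as the
      divisor.\<close>
    moreover have "e / (3 * (K + 1)) > 0" using e K by simp
    ultimately obtain u where u: "u \<in> complex_vector.span S" "dist u v < e / (3 * (K + 1))"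
      unfolding closure_approachable by blast
    have "(K + 1) * norm (v - u) < e / 3"
      using u(2) K by (simp add: dist_norm norm_minus_commute field_simps)
    then have uv: "K * norm (v - u) < e / 3"
      by (simp add: distrib_right) (use norm_ge_zero[of "v - u"] in linarith)
    have d: "dist (T n v) (T n u) < e / 3" for n
      using clinear_norm_leD(4)[OF T, of n "v - u"] uv
      by (simp add: dist_norm clinear_norm_le_diff[OF T])
    obtain M where M: "\<And>m n. m \<ge> M \<Longrightarrow> n \<ge> M \<Longrightarrow> dist (T m u) (T n u) < e / 3"
      using metric_CauchyD[OF convergent_Cauchy[OF span[OF u(1)]], of "e / 3"] e by auto
    have "dist (T m v) (T n v) < e" if "m \<ge> M" "n \<ge> M" for m n
      using d[of m] d[of n] M[OF that]
        dist_triangle[of "T m v" "T n v" "T m u"] dist_triangle2[of "T m u" "T n v" "T n u"]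
      by simp
    then show "\<exists>M. \<forall>m\<ge>M. \<forall>n\<ge>M. dist (T m v) (T n v) < e" by blast
  qed
  then show lim: "(\<lambda>n. T n v) \<longlonglongrightarrow> lim (\<lambda>n. T n v)" for v
    by (simp add: Cauchy_convergent_iff convergent_LIMSEQ_iff)
  show "clinear_norm_le K (\<lambda>v. lim (\<lambda>n. T n v))"
    by (rule clinear_norm_le_limit[OF T lim])
qed

section \<open>Cesaro means of the powers of a unimodular number\<close>

lemma cnj_mult_self_if_unimodular: "cmod z = 1 \<Longrightarrow> cnj z * z = 1"
  using complex_norm_square[of z] by (simp add: mult.commute)

lemma cnj_mult_eq_1_iff:
  assumes "cmod z = 1" shows "cnj z * w = 1 \<longleftrightarrow> w = z"
proof
  assume "cnj z * w = 1"
  then have "(cnj z * z) * w = z" by (simp add: mult.left_commute mult.commute)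
  then show "w = z" by (simp add: cnj_mult_self_if_unimodular[OF assms])
qed (simp add: cnj_mult_self_if_unimodular[OF assms])

text \<open>For \<open>q \<noteq> 1\<close> the geometric sums stay below
  \<open>2 / cmod (q - 1)\<close>, so dividing by \<open>N\<close> sends them to zero; for
  \<open>q = 1\<close> every average with \<open>N > 0\<close> equals 1.\<close>

lemma geometric_average_tendsto:
  assumes "cmod q = 1"
  shows "(\<lambda>N. of_real (1 / real N) * (\<Sum>n<N. q ^ n)) \<longlonglongrightarrow> (if q = 1 then 1 else 0)"
proof (cases "q = 1")
  case True
  have "\<forall>\<^sub>F N in sequentially. of_real (1 / real N) * (\<Sum>n<N. q ^ n) = (1::complex)"
    using eventually_gt_at_top[of 0] by eventually_elim (simp add: True)
  then show ?thesis using True by (simp add: tendsto_eventually)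
next
  case False
  have "(\<lambda>N. of_real (1 / real N) * (\<Sum>n<N. q ^ n)) \<longlonglongrightarrow> 0"
  proof (rule Lim_null_comparison)
    have "cmod (of_real (1 / real N) * (\<Sum>n<N. q ^ n)) \<le> (2 / cmod (q - 1)) * (1 / real N)" for N
    proof -
      have "cmod (\<Sum>n<N. q ^ n) = cmod (q ^ N - 1) / cmod (q - 1)"
        using False by (simp add: geometric_sum norm_divide)
      also have "\<dots> \<le> 2 / cmod (q - 1)"
        using norm_triangle_ineq4[of "q ^ N" 1] assms
        by (intro divide_right_mono) (simp_all add: norm_power)
      finally have "cmod (\<Sum>n<N. q ^ n) * (1 / real N) \<le> (2 / cmod (q - 1)) * (1 / real N)"
        by (rule mult_right_mono) simp
      then show ?thesis
        by (simp only: norm_mult norm_of_real) (simp add: mult.commute)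
    qed
    then show "\<forall>\<^sub>F N in sequentially. cmod (of_real (1 / real N) * (\<Sum>n<N. q ^ n))
        \<le> (2 / cmod (q - 1)) * (1 / real N)"
      by (simp add: always_eventually)
    show "(\<lambda>N. (2 / cmod (q - 1)) * (1 / real N)) \<longlonglongrightarrow> 0"
      by (intro tendsto_mult_right_zero lim_1_over_n)
  qed
  then show ?thesis using False by simp
qed

section \<open>Eigenprojections and the mean ergodic theorem\<close>

locale almost_periodic_unitary =
  fixes U :: "'a::complex_hilbert_space \<Rightarrow> 'a"
  assumes unitary: "unitary_op U" and almost_periodic: "almost_periodic U"
begin

section \<open>Eigenvectors of a unitary operator\<close>

lemma eigenvectors_dense: "closure (complex_vector.span (eigenvectors U)) = UNIV"
  using almost_periodic by (simp add: almost_periodic_def)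

lemma norm_U: "norm (U x) = norm x"
proof -
  obtain V where "is_adjoint V U" "V \<circ> U = id"
    using unitary unfolding unitary_op_def by blast
  then have "cinner (U x) (U x) = cinner x x"
    unfolding is_adjoint_def by (metis comp_apply id_apply)
  then show ?thesis
    by (simp add: norm_eq_sqrt_inner inner_eq_Re_cinner)
qed

lemma clinear_norm_le_U: "clinear_norm_le 1 U"
proof -
  obtain K where "clinear_norm_le K U"
    using unitary unfolding unitary_op_def bounded_clinear_iff by blast
  then show ?thesis
    using norm_U by (auto simp: clinear_norm_le_def)
qed

lemma clinear_norm_le_funpow: "clinear_norm_le 1 (U ^^ n)"
proof (induction n)
  case 0
  show ?case by (rule clinear_norm_leI) simp_all
next
  case (Suc n)
  from clinear_norm_le_comp[OF clinear_norm_le_U this] show ?case by (simp add: o_def)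
qed

lemma funpow_eigen: "v \<in> eigenspace U w \<Longrightarrow> (U ^^ n) v = w ^ n *\<^sub>C v"
  by (induction n)
    (simp_all add: eigenspace_def clinear_norm_leD[OF clinear_norm_le_U] scaleC_scaleC mult.commute)

lemma norm_eigenvalue: "v \<in> eigenspace U w \<Longrightarrow> v \<noteq> 0 \<Longrightarrow> cmod w = 1"
  using norm_U[of v] by (simp add: eigenspace_def norm_scaleC)

lemma eigenvectorsE:
  assumes "v \<in> eigenvectors U"
  obtains w where "v \<in> eigenspace U w" "w \<in> sigma_pp U"
proof -
  obtain w where "v \<noteq> 0" "v \<in> eigenspace U w" using assms unfolding eigenvectors_def by blast
  with norm_eigenvalue that show thesis unfolding sigma_pp_def by blast
qed

lemma norm_sigma_pp: "w \<in> sigma_pp U \<Longrightarrow> cmod w = 1"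
  by (simp add: sigma_pp_def)

text \<open>The adjoint \<open>V\<close> inverts \<open>U\<close>, so it acts on the eigenspace as
  \<open>cnj z\<close>; conjugate linearity in the first argument turns this back into
  \<open>z\<close>.\<close>

lemma cinner_eigen_U:
  assumes "m \<in> eigenspace U z" "cmod z = 1"
  shows "cinner m (U u) = z * cinner m u"
proof -
  obtain V where V: "is_adjoint V U" "V \<circ> U = id" "bounded_clinear V"
    using unitary unfolding unitary_op_def by blast
  obtain K where K: "clinear_norm_le K V" using V(3) unfolding bounded_clinear_iff by blast
  have "m = V (U m)" using V(2) by (metis comp_apply id_apply)
  also have "\<dots> = z *\<^sub>C V m"
    using assms(1) by (simp add: eigenspace_def clinear_norm_leD(2)[OF K])
  finally have "cnj z *\<^sub>C m = cnj z *\<^sub>C z *\<^sub>C V m" by (rule arg_cong)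
  also have "\<dots> = V m"
    by (simp add: scaleC_scaleC cnj_mult_self_if_unimodular[OF assms(2)])
  finally have "V m = cnj z *\<^sub>C m" by (rule sym)
  then show ?thesis
    using V(1) unfolding is_adjoint_def by (metis cinner_scaleC_left complex_cnj_cnj)
qed

lemma cinner_eigen_funpow:
  assumes "m \<in> eigenspace U z" "cmod z = 1"
  shows "cinner m ((U ^^ n) u) = z ^ n * cinner m u"
  by (induction n) (simp_all add: cinner_eigen_U[OF assms])

text \<open>Evaluating \<open>cinner m (U u)\<close> through the left or the right argument gives
  \<open>z\<close> or \<open>w\<close> times \<open>cinner m u\<close>. The case
  \<open>m = 0\<close> is separate because \<open>cmod z = 1\<close> is derived from a nonzero
  eigenvector.\<close>

lemma cinner_eigen_distinct:
  assumes "m \<in> eigenspace U z" "u \<in> eigenspace U w" "z \<noteq> w"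
  shows "cinner m u = 0"
proof (cases "m = 0")
  case True
  then show ?thesis using cinner_scaleC_left[of 0 m u] by simp
next
  case False
  have "cinner m (U u) = z * cinner m u"
    by (rule cinner_eigen_U[OF assms(1) norm_eigenvalue[OF assms(1) False]])
  moreover have "cinner m (U u) = w * cinner m u"
    using assms(2) by (simp add: eigenspace_def cinner_scaleC_right)
  ultimately show ?thesis using assms(3) by simp
qed

section \<open>Cesaro means of the operator \<open>w\<close> times \<open>U\<close>, and their
  limits\<close>

definition twisted_average :: "nat \<Rightarrow> complex \<Rightarrow> 'a \<Rightarrow> 'a" where
  "twisted_average N w u = (1 / real N) *\<^sub>R (\<Sum>n<N. w ^ n *\<^sub>C (U ^^ n) u)"

lemma clinear_norm_le_twisted_average:
  assumes "cmod w = 1" shows "clinear_norm_le 1 (twisted_average N w)"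
  unfolding twisted_average_def
proof (rule clinear_norm_le_average)
  fix n
  show "clinear_norm_le 1 (\<lambda>u. w ^ n *\<^sub>C (U ^^ n) u)"
    using clinear_norm_le_comp[OF clinear_norm_le_scaleC clinear_norm_le_funpow, of "w ^ n" n] assms
    by (simp add: norm_power)
qed simp

text \<open>On an eigenvector the ergodic average becomes a scalar geometric average with ratio
  \<open>w * \<eta>\<close>.\<close>

lemma twisted_average_eigen:
  assumes "u \<in> eigenspace U \<eta>"
  shows "twisted_average N w u = (of_real (1 / real N) * (\<Sum>n<N. (w * \<eta>) ^ n)) *\<^sub>C u"
proof -
  have "(\<Sum>n<N. w ^ n *\<^sub>C (U ^^ n) u) = (\<Sum>n<N. (w * \<eta>) ^ n) *\<^sub>C u"
    by (simp add: funpow_eigen[OF assms] scaleC_scaleC power_mult_distrib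
        complex_vector.scale_sum_left)
  then show ?thesis
    by (simp only: twisted_average_def scaleC_of_real[symmetric] scaleC_scaleC)
qed

lemma twisted_average_eigen_tendsto:
  assumes "u \<in> eigenspace U \<eta>" "cmod w = 1" "cmod \<eta> = 1"
  shows "(\<lambda>N. twisted_average N w u) \<longlonglongrightarrow> (if w * \<eta> = 1 then u else 0)"
proof -
  have "(\<lambda>N. twisted_average N w u) \<longlonglongrightarrow> (if w * \<eta> = 1 then 1 else 0) *\<^sub>C u"
    unfolding twisted_average_eigen[OF assms(1)]
    by (intro clinear_norm_le_tendsto[OF clinear_norm_le_scaleC_left] geometric_average_tendsto)
      (simp add: norm_mult assms)
  moreover have "(if w * \<eta> = 1 then 1 else 0) *\<^sub>C u = (if w * \<eta> = 1 then u else 0)" by simp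
  ultimately show ?thesis by (simp only:)
qed

text \<open>The limit of the twisted averages has the defining property of the orthogonal projection, so
  the existence of the latter comes out of the mean ergodic theorem.\<close>

lemma mean_ergodic:
  assumes z: "cmod z = 1"
  shows "(\<lambda>N. twisted_average N (cnj z) u) \<longlonglongrightarrow> eigenprojection U z u"
    and "clinear_norm_le 1 (eigenprojection U z)"
    and "eigenprojection U z u \<in> eigenspace U z"
    and "m \<in> eigenspace U z \<Longrightarrow> cinner m (eigenprojection U z u) = cinner m u"
proof -
  have cz: "cmod (cnj z) = 1" using z by simp
  note zz = cnj_mult_self_if_unimodular[OF z]
  define L where "L u = lim (\<lambda>N. twisted_average N (cnj z) u)" for u
  have conv: "convergent (\<lambda>N. twisted_average N (cnj z) v)" if "v \<in> eigenvectors U" for v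
    using that
  proof (rule eigenvectorsE)
    fix w assume "v \<in> eigenspace U w" "w \<in> sigma_pp U"
    then show ?thesis
      by (intro convergentI[OF twisted_average_eigen_tendsto[OF _ cz]] norm_sigma_pp)
  qed
  have L: "(\<lambda>N. twisted_average N (cnj z) u) \<longlonglongrightarrow> L u" for u
    unfolding L_def
    by (rule strong_limit_exists_if_dense(1)[OF eigenvectors_dense clinear_norm_le_twisted_average[OF cz] conv])
  have Lb: "clinear_norm_le 1 L"
    by (rule clinear_norm_le_limit[OF clinear_norm_le_twisted_average[OF cz] L])
  \<comment> \<open>Both sides are bounded operators in \<open>u\<close>, so eigenvectors suffice,
    and there \<open>L\<close> either fixes the vector or kills it.\<close>
  have "U (L u) = z *\<^sub>C L u" for u
  proof (rule clinear_norm_le_eq_if_dense[OF eigenvectors_dense,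
        where T = "\<lambda>u. U (L u)" and L = "\<lambda>u. z *\<^sub>C L u" and v = u])
    show "clinear_norm_le (1 * 1) (\<lambda>u. U (L u))"
      by (rule clinear_norm_le_comp[OF clinear_norm_le_U Lb])
    show "clinear_norm_le (cmod z * 1) (\<lambda>u. z *\<^sub>C L u)"
      by (rule clinear_norm_le_comp[OF clinear_norm_le_scaleC Lb])
    fix v assume "v \<in> eigenvectors U"
    then obtain w where w: "v \<in> eigenspace U w" "cmod w = 1"
      by (rule eigenvectorsE) (simp add: norm_sigma_pp)
    have Lv: "L v = (if w = z then v else 0)"
      using LIMSEQ_unique[OF L twisted_average_eigen_tendsto[OF w(1) cz w(2)]]
      by (simp add: cnj_mult_eq_1_iff[OF z])
    show "U (L v) = z *\<^sub>C L v"
      using w(1) by (auto simp: Lv eigenspace_def clinear_norm_le_zero[OF clinear_norm_le_U])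
  qed
  then have Le: "L u \<in> eigenspace U z" for u by (simp add: eigenspace_def)
  have Lo: "cinner m (L u) = cinner m u" if m: "m \<in> eigenspace U z" for m u
  proof (rule LIMSEQ_unique[OF tendsto_cinner[OF L]])
    \<comment> \<open>Moving the power of \<open>U\<close> onto \<open>m\<close> produces
      \<open>z ^ n\<close>, which cancels the twist, so all summands agree. At \<open>N = 0\<close>
      the average is zero, so that index is excluded.\<close>
    have "cinner m (twisted_average N (cnj z) u) = cinner m u" if "N > 0" for N
    proof -
      have lin: "cinner m (\<Sum>n<N. f n) = (\<Sum>n<N. cinner m (f n))" for f :: "nat \<Rightarrow> 'a" and N
        by (induction N) (use cinner_scaleC_right[of m 0 0] in \<open>simp_all add: cinner_add_right\<close>)
      have "cinner m (cnj z ^ n *\<^sub>C (U ^^ n) u) = cinner m u" for n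
        by (simp add: cinner_scaleC_right cinner_eigen_funpow[OF m z] mult.assoc[symmetric]
            power_mult_distrib[symmetric] zz)
      then show ?thesis
        using that
        by (simp add: twisted_average_def scaleC_of_real[symmetric] cinner_scaleC_right lin)
    qed
    then have "\<forall>\<^sub>F N in sequentially. cinner m (twisted_average N (cnj z) u) = cinner m u"
      using eventually_gt_at_top[of 0] by (rule eventually_mono[rotated])
    then show "(\<lambda>N. cinner m (twisted_average N (cnj z) u)) \<longlonglongrightarrow> cinner m u"
      by (rule tendsto_eventually)
  qed
  have "eigenprojection U z u = L u" for u
    unfolding eigenprojection_def orthogonal_projection_def
  proof (rule the_equality)
    have dif: "cinner m (x - y) = cinner m x - cinner m y" for m x y :: 'a
      using cinner_add_right[of m "x - y" y] by simp
    show "L u \<in> eigenspace U z \<and> (\<forall>m\<in>eigenspace U z. cinner m (u - L u) = 0)"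
      using Le Lo by (simp add: dif)
    fix y assume y: "y \<in> eigenspace U z \<and> (\<forall>m\<in>eigenspace U z. cinner m (u - y) = 0)"
    \<comment> \<open>Uniqueness of the projection: the difference of two candidates lies in the
      eigenspace and is orthogonal to it, hence to itself.\<close>
    have "y - L u \<in> eigenspace U z"
      using y Le[of u]
      by (simp add: eigenspace_def clinear_norm_le_diff[OF clinear_norm_le_U]
          complex_vector.scale_right_diff_distrib)
    then have "cinner (y - L u) (y - L u) = 0"
      using y Lo[of "y - L u" u] by (simp add: dif)
    from cinner_eq_zero[OF this] show "y = L u" by simp
  qed
  then have "eigenprojection U z = L" by blast
  then show "(\<lambda>N. twisted_average N (cnj z) u) \<longlonglongrightarrow> eigenprojection U z u"
    and "clinear_norm_le 1 (eigenprojection U z)"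
    and "eigenprojection U z u \<in> eigenspace U z"
    and "m \<in> eigenspace U z \<Longrightarrow> cinner m (eigenprojection U z u) = cinner m u"
    using L Lb Le Lo by simp_all
qed

text \<open>Two descriptions of the limit of the same twisted averages are compared. The zero vector
  is split off since it lies in the eigenspace of every \<open>w\<close>, unimodular or not.\<close>

lemma eigenprojection_eigen:
  assumes "cmod z = 1" "v \<in> eigenspace U w"
  shows "eigenprojection U z v = (if w = z then v else 0)"
proof (cases "v = 0")
  case True
  then show ?thesis using clinear_norm_le_zero[OF mean_ergodic(2)[OF assms(1)]] by simp
next
  case False
  show ?thesis
    using LIMSEQ_unique[OF mean_ergodic(1)[OF assms(1), of v]
        twisted_average_eigen_tendsto[OF assms(2), of "cnj z"]]
      assms(1) norm_eigenvalue[OF assms(2) False] by (simp add: cnj_mult_eq_1_iff)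
qed

section \<open>Pythagoras and Bessel for eigenspaces\<close>

lemma norm_sum_eigenspaces:
  assumes "finite F" "\<And>z. z \<in> F \<Longrightarrow> v z \<in> eigenspace U z"
  shows "(norm (\<Sum>z\<in>F. v z))\<^sup>2 = (\<Sum>z\<in>F. (norm (v z))\<^sup>2)"
  using assms
proof (induction F)
  case (insert z F)
  have "inner (v z) (v w) = 0" if "w \<in> F" for w
  proof -
    have "z \<noteq> w" using that insert.hyps by blast
    then have "cinner (v z) (v w) = 0"
      using that insert.prems by (intro cinner_eigen_distinct[of _ z _ w]) auto
    then show ?thesis by (simp add: inner_eq_Re_cinner)
  qed
  then have "inner (v z) (\<Sum>z\<in>F. v z) = 0"
    by (simp add: inner_sum_right)
  then show ?case
    using insert by (simp add: power2_norm_eq_inner inner_add inner_commute)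
qed simp

text \<open>The sum \<open>p\<close> of the projections satisfies
  \<open>inner p v = (norm p)\<^sup>2\<close>, so Cauchy-Schwarz gives
  \<open>norm p \<le> norm v\<close>, and Pythagoras expands \<open>norm p\<close>.\<close>

lemma eigenprojection_Bessel:
  assumes "finite F" "\<And>z. z \<in> F \<Longrightarrow> cmod z = 1"
  shows "(\<Sum>z\<in>F. (norm (eigenprojection U z v))\<^sup>2) \<le> (norm v)\<^sup>2"
proof -
  define p where "p = (\<Sum>z\<in>F. eigenprojection U z v)"
  have "inner (eigenprojection U z v) v = (norm (eigenprojection U z v))\<^sup>2" if "z \<in> F" for z
    using mean_ergodic(4)[OF assms(2)[OF that] mean_ergodic(3)[OF assms(2)[OF that]], of v v]
    by (simp add: inner_eq_Re_cinner power2_norm_eq_inner)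
  then have "inner p v = (\<Sum>z\<in>F. (norm (eigenprojection U z v))\<^sup>2)"
    by (simp add: p_def inner_sum_left)
  also have "\<dots> = (norm p)\<^sup>2"
    unfolding p_def using assms mean_ergodic(3) by (intro norm_sum_eigenspaces[symmetric]) auto
  finally have eq: "inner p v = (norm p)\<^sup>2" "(norm p)\<^sup>2 = (\<Sum>z\<in>F. (norm (eigenprojection U z v))\<^sup>2)"
    using \<open>_ = (norm p)\<^sup>2\<close> by simp_all
  have "(norm p)\<^sup>2 \<le> norm p * norm v"
    using norm_cauchy_schwarz[of p v] eq(1) by simp
  then have "norm p \<le> norm v"
    by (cases "norm p = 0") (simp_all add: power2_eq_square)
  then show ?thesis
    using eq(2) power_mono[of "norm p" "norm v" 2] by simp
qed

text \<open>The right-hand projections of the spectral sums carry conjugated eigenvalues;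
  conjugation is injective, so reindexing suffices.\<close>

lemma eigenprojection_Bessel_cnj:
  assumes "finite F" "\<And>z. z \<in> F \<Longrightarrow> cmod z = 1"
  shows "(\<Sum>z\<in>F. (norm (eigenprojection U (cnj z) v))\<^sup>2) \<le> (norm v)\<^sup>2"
proof -
  have "inj_on cnj F" by (auto intro: inj_onI)
  then have "(\<Sum>z\<in>F. (norm (eigenprojection U (cnj z) v))\<^sup>2) =
      (\<Sum>z\<in>cnj ` F. (norm (eigenprojection U z v))\<^sup>2)"
    by (simp add: sum.reindex)
  also have "\<dots> \<le> (norm v)\<^sup>2"
    using assms by (intro eigenprojection_Bessel) auto
  finally show ?thesis .
qed

end

section \<open>Diagonal and crossed limits\<close>

text \<open>The uniform bound controls the error made by replacing \<open>f i\<close> with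
  \<open>u\<close>, so the operators need to converge only at \<open>u\<close>.\<close>

lemma tendsto_strong_apply:
  assumes "\<forall>\<^sub>F i in F. clinear_norm_le K (S i)" "((\<lambda>i. S i u) \<longlongrightarrow> l) F" "(f \<longlongrightarrow> u) F"
  shows "((\<lambda>i. S i (f i)) \<longlongrightarrow> l) F"
proof (rule Lim_transform[OF assms(2)])
  show "((\<lambda>i. S i (f i) - S i u) \<longlongrightarrow> 0) F"
  proof (rule Lim_null_comparison)
    show "\<forall>\<^sub>F i in F. norm (S i (f i) - S i u) \<le> K * norm (f i - u)"
      using assms(1) by (rule eventually_mono) (metis clinear_norm_leD(4) clinear_norm_le_diff)
    show "((\<lambda>i. K * norm (f i - u)) \<longlongrightarrow> 0) F"
      by (rule tendsto_mult_right_zero[OF tendsto_norm_zero[OF LIM_zero[OF assms(3)]]])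
  qed
qed

text \<open>
  What the averages over \<open>N\<close> and the sums over finite sets of eigenvalues have in common: \<open>Q\<close> is
  the diagonal operation, \<open>e i w\<close> its approximation of the projection onto the eigenspace of
  \<open>cnj w\<close>, and \<open>R\<close> the crossed operation of the partition \<open>1212\<close>.
\<close>

locale averaging_scheme = almost_periodic_unitary U
  for U :: "'a::complex_hilbert_space \<Rightarrow> 'a" +
  fixes \<F> :: "'i filter"
    and Q :: "'i \<Rightarrow> ('a \<Rightarrow> 'a) \<Rightarrow> 'a \<Rightarrow> 'a"
    and e :: "'i \<Rightarrow> complex \<Rightarrow> 'a \<Rightarrow> 'a"
    and R :: "'i \<Rightarrow> ('a \<Rightarrow> 'a) \<Rightarrow> ('a \<Rightarrow> 'a) \<Rightarrow> ('a \<Rightarrow> 'a) \<Rightarrow> 'a \<Rightarrow> 'a"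
  assumes Q_bound: "\<forall>\<^sub>F i in \<F>. \<forall>K D. clinear_norm_le K D \<longrightarrow> clinear_norm_le K (Q i D)"
    and Q_eigen: "\<forall>\<^sub>F i in \<F>. \<forall>K D w v. clinear_norm_le K D \<longrightarrow> w \<in> sigma_pp U \<longrightarrow>
      v \<in> eigenspace U w \<longrightarrow> Q i D v = e i w (D v)"
    and e_bound: "w \<in> sigma_pp U \<Longrightarrow> \<forall>\<^sub>F i in \<F>. clinear_norm_le 1 (e i w)"
    and e_tendsto: "w \<in> sigma_pp U \<Longrightarrow> ((\<lambda>i. e i w u) \<longlongrightarrow> eigenprojection U (cnj w) u) \<F>"
    and R_bound: "clinear_norm_le a A \<Longrightarrow> clinear_norm_le b B \<Longrightarrow> clinear_norm_le c C \<Longrightarrow>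
      \<forall>\<^sub>F i in \<F>. clinear_norm_le (a * b * c) (R i A B C)"
    and R_eigen: "clinear_norm_le a A \<Longrightarrow> clinear_norm_le b B \<Longrightarrow> clinear_norm_le c C \<Longrightarrow>
      w \<in> sigma_pp U \<Longrightarrow> v \<in> eigenspace U w \<Longrightarrow>
      \<forall>\<^sub>F i in \<F>. R i A B C v = Q i (\<lambda>x. A (e i w (B x))) (C v)"
begin

lemma Q_eigen_tendsto:
  assumes D: "\<forall>\<^sub>F i in \<F>. clinear_norm_le K (D i)" and lim: "((\<lambda>i. D i v) \<longlongrightarrow> D' v) \<F>"
    and v: "v \<in> eigenspace U w" "w \<in> sigma_pp U"
  shows "((\<lambda>i. Q i (D i) v) \<longlongrightarrow> eigenprojection U (cnj w) (D' v)) \<F>"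
proof -
  have "((\<lambda>i. e i w (D i v)) \<longlongrightarrow> eigenprojection U (cnj w) (D' v)) \<F>"
    by (rule tendsto_strong_apply[OF e_bound[OF v(2)] e_tendsto[OF v(2)] lim])
  \<comment> \<open>\<open>Q_eigen\<close> quantifies over the operator inside the eventuality, so
    an operator depending on \<open>i\<close> may be inserted.\<close>
  moreover have "\<forall>\<^sub>F i in \<F>. e i w (D i v) = Q i (D i) v"
    using D Q_eigen by eventually_elim (metis v)
  ultimately show ?thesis by (simp add: tendsto_cong)
qed

lemma Q_bound_family:
  assumes "\<forall>\<^sub>F i in \<F>. clinear_norm_le K (D i)"
  shows "\<forall>\<^sub>F i in \<F>. clinear_norm_le K (Q i (D i))"
  using assms Q_bound by eventually_elim blast

end

section \<open>The scheme of Cesaro averages\<close>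

context almost_periodic_unitary
begin

definition diagonal_average :: "nat \<Rightarrow> ('a \<Rightarrow> 'a) \<Rightarrow> 'a \<Rightarrow> 'a" where
  "diagonal_average N D v = (1 / real N) *\<^sub>R (\<Sum>n<N. (U ^^ n) (D ((U ^^ n) v)))"

text \<open>The factor \<open>1 / N\<^sup>2\<close> is split between the two sums, so that each of
  them is an average to which the norm bound for averages applies.\<close>

definition crossed_average ::
  "nat \<Rightarrow> ('a \<Rightarrow> 'a) \<Rightarrow> ('a \<Rightarrow> 'a) \<Rightarrow> ('a \<Rightarrow> 'a) \<Rightarrow> 'a \<Rightarrow> 'a" where
  "crossed_average N A B C v = (1 / real N) *\<^sub>R (\<Sum>n<N. (1 / real N) *\<^sub>R
     (\<Sum>m<N. (U ^^ n) (A ((U ^^ m) (B ((U ^^ n) (C ((U ^^ m) v))))))))"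

lemma clinear_norm_le_conj_funpow:
  assumes "clinear_norm_le K D" shows "clinear_norm_le K (\<lambda>v. (U ^^ n) (D ((U ^^ m) v)))"
  using clinear_norm_le_comp[OF clinear_norm_le_funpow
      clinear_norm_le_comp[OF assms clinear_norm_le_funpow], of n m] by simp

lemma diagonal_average_eigen:
  assumes "clinear_norm_le K D" "v \<in> eigenspace U w"
  shows "diagonal_average N D v = twisted_average N w (D v)"
  by (simp add: diagonal_average_def twisted_average_def funpow_eigen[OF assms(2)]
      clinear_norm_leD(2)[OF assms(1)] clinear_norm_leD(2)[OF clinear_norm_le_funpow])

lemma clinear_norm_le_crossed_average:
  assumes A: "clinear_norm_le a A" and B: "clinear_norm_le b B" and C: "clinear_norm_le c C"
  shows "clinear_norm_le (a * b * c) (crossed_average N A B C)"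
proof -
  have 1: "clinear_norm_le (a * b * c) (\<lambda>v. (U ^^ n) (A ((U ^^ m) (B ((U ^^ n) (C ((U ^^ m) v)))))))"
    for n m
    using clinear_norm_le_conj_funpow[OF clinear_norm_le_comp[OF
          clinear_norm_le_comp[OF A clinear_norm_le_conj_funpow[OF B, of m n]] C], of n m] .
  show ?thesis
    unfolding crossed_average_def
    by (intro clinear_norm_le_average 1 clinear_norm_leD(3)[OF 1])
qed

text \<open>The rightmost power \<open>U ^^ m\<close> turns into the scalar \<open>w ^ m\<close>,
  which joins the other \<open>U ^^ m\<close> to a twisted average. What remains is a diagonal
  average over \<open>n\<close>, evaluated at \<open>C v\<close>.\<close>

lemma crossed_average_eigen:
  assumes A: "clinear_norm_le a A" and B: "clinear_norm_le b B" and C: "clinear_norm_le c C"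
    and v: "v \<in> eigenspace U w"
  shows "crossed_average N A B C v = diagonal_average N (\<lambda>x. A (twisted_average N w (B x))) (C v)"
  by (simp add: crossed_average_def diagonal_average_def twisted_average_def funpow_eigen[OF v]
      clinear_norm_leD(2)[OF A] clinear_norm_leD(2)[OF B] clinear_norm_leD(2)[OF C]
      clinear_norm_leD(2)[OF clinear_norm_le_funpow] clinear_norm_le_scaleR[OF A]
      clinear_norm_le_scaleR[OF clinear_norm_le_funpow] clinear_norm_le_sum[OF A]
      clinear_norm_le_sum[OF clinear_norm_le_funpow])

lemma averaging_scheme_averages:
  "averaging_scheme U sequentially diagonal_average twisted_average crossed_average"
proof unfold_locales
  show "\<forall>\<^sub>F N in sequentially. \<forall>K D. clinear_norm_le K D \<longrightarrow> clinear_norm_le K (diagonal_average N D)"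
    unfolding diagonal_average_def
    by (intro always_eventually allI impI clinear_norm_le_average clinear_norm_le_conj_funpow)
      (auto dest: clinear_norm_leD(3))
  show "\<forall>\<^sub>F N in sequentially. \<forall>K D w v. clinear_norm_le K D \<longrightarrow> w \<in> sigma_pp U \<longrightarrow>
      v \<in> eigenspace U w \<longrightarrow> diagonal_average N D v = twisted_average N w (D v)"
    using diagonal_average_eigen by (intro always_eventually) blast
  fix w :: complex assume "w \<in> sigma_pp U"
  then have w: "cmod w = 1" by (rule norm_sigma_pp)
  show "\<forall>\<^sub>F N in sequentially. clinear_norm_le 1 (twisted_average N w)"
    using clinear_norm_le_twisted_average[OF w] by (intro always_eventually) blast
  show "(\<lambda>N. twisted_average N w u) \<longlonglongrightarrow> eigenprojection U (cnj w) u" for u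
    using mean_ergodic(1)[of "cnj w"] w by simp
next
  fix a b c and A B C :: "'a \<Rightarrow> 'a"
  assume h: "clinear_norm_le a A" "clinear_norm_le b B" "clinear_norm_le c C"
  show "\<forall>\<^sub>F N in sequentially. clinear_norm_le (a * b * c) (crossed_average N A B C)"
    using clinear_norm_le_crossed_average[OF h] by (intro always_eventually) blast
  show "\<forall>\<^sub>F N in sequentially. crossed_average N A B C v =
      diagonal_average N (\<lambda>x. A (twisted_average N w (B x))) (C v)"
    if "v \<in> eigenspace U w" for w v
    using crossed_average_eigen[OF h that] by (intro always_eventually) blast
qed

interpretation avg: averaging_scheme U sequentially diagonal_average twisted_average crossed_average
  by (rule averaging_scheme_averages)

text \<open>Defined through the averages, where completeness provides existence along a sequence;
  the spectral sums are then compared with it on eigenvectors.\<close>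

definition diagonal_limit :: "('a \<Rightarrow> 'a) \<Rightarrow> 'a \<Rightarrow> 'a" where
  "diagonal_limit D v = lim (\<lambda>N. diagonal_average N D v)"

definition crossed_limit :: "('a \<Rightarrow> 'a) \<Rightarrow> ('a \<Rightarrow> 'a) \<Rightarrow> ('a \<Rightarrow> 'a) \<Rightarrow> 'a \<Rightarrow> 'a" where
  "crossed_limit A B C v = lim (\<lambda>N. crossed_average N A B C v)"

text \<open>The formula on eigenvectors mentions only eigenprojections. It determines the operator
  by density and makes it a common target for all averaging schemes.\<close>

lemma diagonal_limit:
  assumes D: "clinear_norm_le K D"
  shows "clinear_norm_le K (diagonal_limit D)"
    and "v \<in> eigenspace U w \<Longrightarrow> w \<in> sigma_pp U \<Longrightarrow>
      diagonal_limit D v = eigenprojection U (cnj w) (D v)"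
proof -
  have b: "clinear_norm_le K (diagonal_average N D)" for N
    unfolding diagonal_average_def
    by (intro clinear_norm_le_average clinear_norm_le_conj_funpow D clinear_norm_leD(3)[OF D])
  have e: "(\<lambda>N. diagonal_average N D v) \<longlonglongrightarrow> eigenprojection U (cnj w) (D v)"
    if "v \<in> eigenspace U w" "w \<in> sigma_pp U" for v w
    using avg.Q_eigen_tendsto[of K "\<lambda>_. D" v D w] D that by simp
  then have "convergent (\<lambda>N. diagonal_average N D v)" if "v \<in> eigenvectors U" for v
    using that by (meson convergentI eigenvectorsE)
  from strong_limit_exists_if_dense(2)[OF eigenvectors_dense b this]
  show "clinear_norm_le K (diagonal_limit D)"
    unfolding diagonal_limit_def[abs_def] .
  show "v \<in> eigenspace U w \<Longrightarrow> w \<in> sigma_pp U \<Longrightarrow>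
      diagonal_limit D v = eigenprojection U (cnj w) (D v)"
    unfolding diagonal_limit_def using e by (blast intro: limI)
qed

end

section \<open>Convergence in an arbitrary averaging scheme\<close>

context averaging_scheme
begin

text \<open>Density reduces the claim to eigenvectors. The argument \<open>D i\<close> varies with
  \<open>i\<close> because the nested and crossed partitions put index-dependent operators inside
  \<open>Q\<close>.\<close>

lemma Q_tendsto:
  assumes D: "\<forall>\<^sub>F i in \<F>. clinear_norm_le K (D i)" and lim: "\<And>v. ((\<lambda>i. D i v) \<longlongrightarrow> D' v) \<F>"
    and D': "clinear_norm_le K' D'"
  shows "((\<lambda>i. Q i (D i) v) \<longlongrightarrow> diagonal_limit D' v) \<F>"
proof (rule strong_limit_if_dense[OF eigenvectors_dense Q_bound_family[OF D] diagonal_limit(1)[OF D']])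
  fix v assume "v \<in> eigenvectors U"
  then obtain w where w: "v \<in> eigenspace U w" "w \<in> sigma_pp U" by (rule eigenvectorsE)
  show "((\<lambda>i. Q i (D i) v) \<longlongrightarrow> diagonal_limit D' v) \<F>"
    unfolding diagonal_limit(2)[OF D' w] by (rule Q_eigen_tendsto[where D = D and D' = D', OF D lim w])
qed

lemma Q_tendsto_const:
  assumes "clinear_norm_le K D"
  shows "((\<lambda>i. Q i D v) \<longlongrightarrow> diagonal_limit D v) \<F>"
  using Q_tendsto[of K "\<lambda>_. D" D K v] assms by simp

text \<open>Strong limits may be multiplied because the left factors \<open>Q i A\<close> are
  uniformly bounded.\<close>

lemma adjacent_tendsto:
  assumes "clinear_norm_le a A" "clinear_norm_le b B" "clinear_norm_le c C"
  shows "((\<lambda>i. Q i A (B (Q i C v))) \<longlongrightarrow> diagonal_limit A (B (diagonal_limit C v))) \<F>"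
proof (rule tendsto_strong_apply[OF Q_bound_family])
  show "\<forall>\<^sub>F i in \<F>. clinear_norm_le a A" using assms(1) by simp
  show "((\<lambda>i. Q i A (B (diagonal_limit C v))) \<longlongrightarrow> diagonal_limit A (B (diagonal_limit C v))) \<F>"
    by (rule Q_tendsto_const[OF assms(1)])
  show "((\<lambda>i. B (Q i C v)) \<longlongrightarrow> B (diagonal_limit C v)) \<F>"
    by (rule clinear_norm_le_tendsto[OF assms(2) Q_tendsto_const[OF assms(3)]])
qed

text \<open>The inner diagonal operation is a bounded, strongly convergent family, hence an
  admissible varying argument of the outer one.\<close>

lemma nested_tendsto:
  assumes "clinear_norm_le a A" "clinear_norm_le b B" "clinear_norm_le c C"
  shows "((\<lambda>i. Q i (\<lambda>x. A (Q i B (C x))) v) \<longlongrightarrow>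
    diagonal_limit (\<lambda>x. A (diagonal_limit B (C x))) v) \<F>"
proof (rule Q_tendsto)
  have "\<forall>\<^sub>F i in \<F>. clinear_norm_le b (Q i B)"
    using Q_bound_family[of b "\<lambda>_. B"] assms(2) by simp
  then show "\<forall>\<^sub>F i in \<F>. clinear_norm_le (a * (b * c)) (\<lambda>x. A (Q i B (C x)))"
    by (rule eventually_mono) (intro clinear_norm_le_comp assms)
  show "clinear_norm_le (a * (b * c)) (\<lambda>x. A (diagonal_limit B (C x)))"
    by (intro clinear_norm_le_comp assms diagonal_limit)
  show "((\<lambda>i. A (Q i B (C v))) \<longlongrightarrow> A (diagonal_limit B (C v))) \<F>" for v
    by (rule clinear_norm_le_tendsto[OF assms(1) Q_tendsto_const[OF assms(2)]])
qed

text \<open>An eigenvector freezes one of the two entangled indices, leaving a diagonal operation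
  with a convergent argument.\<close>

lemma R_eigen_tendsto:
  assumes A: "clinear_norm_le a A" and B: "clinear_norm_le b B" and C: "clinear_norm_le c C"
    and w: "v \<in> eigenspace U w" "w \<in> sigma_pp U"
  shows "((\<lambda>i. R i A B C v) \<longlongrightarrow>
    diagonal_limit (\<lambda>x. A (eigenprojection U (cnj w) (B x))) (C v)) \<F>"
proof -
  have "((\<lambda>i. Q i (\<lambda>x. A (e i w (B x))) (C v)) \<longlongrightarrow>
      diagonal_limit (\<lambda>x. A (eigenprojection U (cnj w) (B x))) (C v)) \<F>"
  proof (rule Q_tendsto)
    show "\<forall>\<^sub>F i in \<F>. clinear_norm_le (a * (1 * b)) (\<lambda>x. A (e i w (B x)))"
      using e_bound[OF w(2)] by (rule eventually_mono) (intro clinear_norm_le_comp A B)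
    show "clinear_norm_le (a * (1 * b)) (\<lambda>x. A (eigenprojection U (cnj w) (B x)))"
      using norm_sigma_pp[OF w(2)] by (intro clinear_norm_le_comp A B mean_ergodic) simp
    show "((\<lambda>i. A (e i w (B x))) \<longlongrightarrow> A (eigenprojection U (cnj w) (B x))) \<F>" for x
      by (rule clinear_norm_le_tendsto[OF A e_tendsto[OF w(2)]])
  qed
  then show ?thesis
    using R_eigen[OF A B C w(2,1)] by (simp add: tendsto_cong)
qed

end

context almost_periodic_unitary
begin

interpretation avg: averaging_scheme U sequentially diagonal_average twisted_average crossed_average
  by (rule averaging_scheme_averages)

text \<open>As in the diagonal case, the values on eigenvectors involve no particular scheme, which
  makes this limit common to both.\<close>

lemma crossed_limit:
  assumes h: "clinear_norm_le a A" "clinear_norm_le b B" "clinear_norm_le c C"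
  shows "clinear_norm_le (a * b * c) (crossed_limit A B C)"
    and "v \<in> eigenspace U w \<Longrightarrow> w \<in> sigma_pp U \<Longrightarrow> crossed_limit A B C v =
      diagonal_limit (\<lambda>x. A (eigenprojection U (cnj w) (B x))) (C v)"
proof -
  have "convergent (\<lambda>N. crossed_average N A B C v)" if "v \<in> eigenvectors U" for v
    using that avg.R_eigen_tendsto[OF h] by (meson convergentI eigenvectorsE)
  from strong_limit_exists_if_dense(2)[OF eigenvectors_dense clinear_norm_le_crossed_average[OF h] this]
  show "clinear_norm_le (a * b * c) (crossed_limit A B C)"
    unfolding crossed_limit_def[abs_def] .
  show "v \<in> eigenspace U w \<Longrightarrow> w \<in> sigma_pp U \<Longrightarrow> crossed_limit A B C v =
      diagonal_limit (\<lambda>x. A (eigenprojection U (cnj w) (B x))) (C v)"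
    unfolding crossed_limit_def using avg.R_eigen_tendsto[OF h] by (blast intro: limI)
qed

end

context averaging_scheme
begin

lemma crossed_tendsto:
  assumes h: "clinear_norm_le a A" "clinear_norm_le b B" "clinear_norm_le c C"
  shows "((\<lambda>i. R i A B C v) \<longlongrightarrow> crossed_limit A B C v) \<F>"
proof (rule strong_limit_if_dense[OF eigenvectors_dense R_bound[OF h] crossed_limit(1)[OF h]])
  fix v assume "v \<in> eigenvectors U"
  then obtain w where w: "v \<in> eigenspace U w" "w \<in> sigma_pp U" by (rule eigenvectorsE)
  show "((\<lambda>i. R i A B C v) \<longlongrightarrow> crossed_limit A B C v) \<F>"
    unfolding crossed_limit(2)[OF h w] by (rule R_eigen_tendsto[OF h w])
qed

end

section \<open>The scheme of finite spectral sums\<close>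

context almost_periodic_unitary
begin

definition spectral_diagonal :: "complex set \<Rightarrow> ('a \<Rightarrow> 'a) \<Rightarrow> 'a \<Rightarrow> 'a" where
  "spectral_diagonal F D v = (\<Sum>z\<in>F. eigenprojection U z (D (eigenprojection U (cnj z) v)))"

text \<open>The counterpart of \<open>twisted_average\<close>: on an eigenvector for
  \<open>w\<close> only the summand with index \<open>cnj w\<close> survives, provided that
  \<open>F\<close> contains it.\<close>

definition truncated_eigenprojection :: "complex set \<Rightarrow> complex \<Rightarrow> 'a \<Rightarrow> 'a" where
  "truncated_eigenprojection F w u = (if cnj w \<in> F then eigenprojection U (cnj w) u else 0)"

definition spectral_crossed ::
  "complex set \<Rightarrow> ('a \<Rightarrow> 'a) \<Rightarrow> ('a \<Rightarrow> 'a) \<Rightarrow> ('a \<Rightarrow> 'a) \<Rightarrow> 'a \<Rightarrow> 'a" where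
  "spectral_crossed F A B C v = (\<Sum>z\<in>F. \<Sum>w\<in>F. eigenprojection U z (A (eigenprojection U w
     (B (eigenprojection U (cnj z) (C (eigenprojection U (cnj w) v)))))))"

text \<open>The bound is requested in squared form, as Pythagoras and Bessel deliver it; the
  triangle inequality would give a bound growing with \<open>F\<close>.\<close>

lemma clinear_norm_le_sum_op:
  assumes "\<And>z. z \<in> F \<Longrightarrow> clinear_norm_le (L z) (T z)" "0 \<le> K"
    and "\<And>v. (norm (\<Sum>z\<in>F. T z v))\<^sup>2 \<le> (K * norm v)\<^sup>2"
  shows "clinear_norm_le K (\<lambda>v. \<Sum>z\<in>F. T z v)"
proof (rule clinear_norm_leI)
  show "norm (\<Sum>z\<in>F. T z v) \<le> K * norm v" for v
    using assms(2) by (intro power2_le_imp_le[OF assms(3)]) simp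
qed (use assms(2) clinear_norm_leD(1,2)[OF assms(1)] in
    \<open>simp_all add: sum.distrib complex_vector.scale_sum_right\<close>)

lemma clinear_norm_le_eigenprojection_comp:
  assumes "cmod z = 1" "clinear_norm_le K D"
  shows "clinear_norm_le K (\<lambda>x. eigenprojection U z (D x))"
  using clinear_norm_le_comp[OF mean_ergodic(2)[OF assms(1)] assms(2)] by simp

lemma clinear_norm_le_comp_eigenprojection:
  assumes "cmod z = 1" "clinear_norm_le K D"
  shows "clinear_norm_le K (\<lambda>x. D (eigenprojection U z x))"
  using clinear_norm_le_comp[OF assms(2) mean_ergodic(2)[OF assms(1)]] by simp

lemma eigenprojection_comp_square_le:
  assumes "cmod z = 1" "clinear_norm_le K D"
  shows "(norm (eigenprojection U z (D x)))\<^sup>2 \<le> K\<^sup>2 * (norm x)\<^sup>2"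
proof -
  have "norm (eigenprojection U z (D x)) \<le> K * norm x"
    by (rule clinear_norm_leD(4)[OF clinear_norm_le_eigenprojection_comp[OF assms]])
  then show ?thesis
    unfolding power_mult_distrib[symmetric] by (rule power_mono) simp
qed

text \<open>The left projections make the summands orthogonal, and Bessel's inequality for the right
  projections keeps the total independent of the size of \<open>F\<close>.\<close>

lemma clinear_norm_le_spectral_diagonal:
  assumes F: "finite F" "\<And>z. z \<in> F \<Longrightarrow> cmod z = 1" and D: "clinear_norm_le K D"
  shows "clinear_norm_le K (spectral_diagonal F D)"
  unfolding spectral_diagonal_def[abs_def]
proof (rule clinear_norm_le_sum_op)
  show "clinear_norm_le K (\<lambda>v. eigenprojection U z (D (eigenprojection U (cnj z) v)))"
    if "z \<in> F" for z
    using F(2)[OF that]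
    by (intro clinear_norm_le_eigenprojection_comp clinear_norm_le_comp_eigenprojection[OF _ D]) simp_all
  show "0 \<le> K" by (rule clinear_norm_leD(3)[OF D])
  fix v
  have "(norm (\<Sum>z\<in>F. eigenprojection U z (D (eigenprojection U (cnj z) v))))\<^sup>2 =
      (\<Sum>z\<in>F. (norm (eigenprojection U z (D (eigenprojection U (cnj z) v))))\<^sup>2)"
    using F by (intro norm_sum_eigenspaces mean_ergodic) auto
  also have "\<dots> \<le> (\<Sum>z\<in>F. K\<^sup>2 * (norm (eigenprojection U (cnj z) v))\<^sup>2)"
    using F by (intro sum_mono eigenprojection_comp_square_le D) auto
  also have "\<dots> \<le> K\<^sup>2 * (norm v)\<^sup>2"
    unfolding sum_distrib_left[symmetric]
    using F by (intro mult_left_mono eigenprojection_Bessel_cnj) auto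
  finally show "(norm (\<Sum>z\<in>F. eigenprojection U z (D (eigenprojection U (cnj z) v))))\<^sup>2
      \<le> (K * norm v)\<^sup>2"
    by (simp add: power_mult_distrib)
qed

lemma spectral_diagonal_eigen:
  assumes F: "finite F" "\<And>z. z \<in> F \<Longrightarrow> cmod z = 1" and D: "clinear_norm_le K D"
    and v: "v \<in> eigenspace U w"
  shows "spectral_diagonal F D v = truncated_eigenprojection F w (D v)"
proof -
  have "eigenprojection U z (D (eigenprojection U (cnj z) v)) =
      (if z = cnj w then eigenprojection U (cnj w) (D v) else 0)" if "z \<in> F" for z
    using F(2)[OF that] eigenprojection_eigen[OF _ v, of "cnj z"]
    by (auto simp: clinear_norm_le_zero[OF D] clinear_norm_le_zero[OF mean_ergodic(2)])
  then have "spectral_diagonal F D v =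
      (\<Sum>z\<in>F. if z = cnj w then eigenprojection U (cnj w) (D v) else 0)"
    unfolding spectral_diagonal_def by (intro sum.cong) auto
  then show ?thesis
    using F(1) by (simp add: truncated_eigenprojection_def)
qed

text \<open>The layers are peeled off from the left: Pythagoras in \<open>z\<close>, the bound of
  \<open>A\<close>, Pythagoras in \<open>w\<close>, the bound of \<open>B\<close>, Bessel in
  \<open>z\<close>, the bound of \<open>C\<close>, Bessel in \<open>w\<close>.\<close>

lemma clinear_norm_le_spectral_crossed:
  assumes F: "finite F" "\<And>z. z \<in> F \<Longrightarrow> cmod z = 1"
    and A: "clinear_norm_le a A" and B: "clinear_norm_le b B" and C: "clinear_norm_le c C"
  shows "clinear_norm_le (a * b * c) (spectral_crossed F A B C)"
proof -
  let ?E = "eigenprojection U"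
  let ?T = "\<lambda>z w v. ?E w (B (?E (cnj z) (C (?E (cnj w) v))))"
  have T: "clinear_norm_le (a * (b * c)) (\<lambda>v. ?E z (A (?T z w v)))" if "z \<in> F" "w \<in> F" for z w
  proof -
    have cz: "cmod (cnj z) = 1" and cw: "cmod (cnj w) = 1" using F(2) that by simp_all
    have "clinear_norm_le (b * c) (\<lambda>v. B (?E (cnj z) (C (?E (cnj w) v))))"
      by (rule clinear_norm_le_comp[OF B clinear_norm_le_eigenprojection_comp[OF cz
              clinear_norm_le_comp_eigenprojection[OF cw C]]])
    then have "clinear_norm_le (b * c) (?T z w)"
      by (rule clinear_norm_le_eigenprojection_comp[OF F(2)[OF that(2)]])
    from clinear_norm_le_eigenprojection_comp[OF F(2)[OF that(1)] clinear_norm_le_comp[OF A this]]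
    show ?thesis .
  qed
  \<comment> \<open>The double sum is written over pairs to fit the criterion for a single index
    set.\<close>
  have "clinear_norm_le (a * b * c) (\<lambda>v. \<Sum>p\<in>F \<times> F. ?E (fst p) (A (?T (fst p) (snd p) v)))"
  proof (rule clinear_norm_le_sum_op)
    show "clinear_norm_le (a * (b * c)) (\<lambda>v. ?E (fst p) (A (?T (fst p) (snd p) v)))"
      if "p \<in> F \<times> F" for p
      by (rule T) (use that in auto)
    show "0 \<le> a * b * c"
      using clinear_norm_leD(3)[OF A] clinear_norm_leD(3)[OF B] clinear_norm_leD(3)[OF C] by simp
    fix v
    have "(\<Sum>p\<in>F \<times> F. ?E (fst p) (A (?T (fst p) (snd p) v))) =
        (\<Sum>z\<in>F. ?E z (A (\<Sum>w\<in>F. ?T z w v)))"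
      using F(2)
      by (simp add: sum.cartesian_product' clinear_norm_le_sum[OF A]
          clinear_norm_le_sum[OF mean_ergodic(2)] cong: sum.cong)
    then have "(norm (\<Sum>p\<in>F \<times> F. ?E (fst p) (A (?T (fst p) (snd p) v))))\<^sup>2 =
        (\<Sum>z\<in>F. (norm (?E z (A (\<Sum>w\<in>F. ?T z w v))))\<^sup>2)"
      using F by (simp add: norm_sum_eigenspaces mean_ergodic)
    also have "\<dots> \<le> (\<Sum>z\<in>F. a\<^sup>2 * (norm (\<Sum>w\<in>F. ?T z w v))\<^sup>2)"
      using F by (intro sum_mono eigenprojection_comp_square_le A) auto
    also have "\<dots> = a\<^sup>2 * (\<Sum>z\<in>F. \<Sum>w\<in>F. (norm (?T z w v))\<^sup>2)"
      using F by (simp add: norm_sum_eigenspaces mean_ergodic sum_distrib_left)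
    also have "\<dots> \<le> a\<^sup>2 * (\<Sum>z\<in>F. \<Sum>w\<in>F. b\<^sup>2 * (norm (?E (cnj z) (C (?E (cnj w) v))))\<^sup>2)"
      using F by (intro mult_left_mono sum_mono eigenprojection_comp_square_le B) auto
    \<comment> \<open>Exchanging the sums puts \<open>z\<close> inside: for fixed \<open>w\<close>
      the projections for \<open>cnj z\<close> act on one and the same vector, as Bessel's
      inequality requires.\<close>
    also have "\<dots> = a\<^sup>2 * b\<^sup>2 * (\<Sum>w\<in>F. \<Sum>z\<in>F. (norm (?E (cnj z) (C (?E (cnj w) v))))\<^sup>2)"
      by (subst sum.swap) (simp add: sum_distrib_left mult.assoc)
    also have "\<dots> \<le> a\<^sup>2 * b\<^sup>2 * (\<Sum>w\<in>F. (norm (C (?E (cnj w) v)))\<^sup>2)"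
      using F by (intro mult_left_mono sum_mono eigenprojection_Bessel_cnj) auto
    also have "\<dots> \<le> a\<^sup>2 * b\<^sup>2 * (\<Sum>w\<in>F. c\<^sup>2 * (norm (?E (cnj w) v))\<^sup>2)"
    proof (intro mult_left_mono sum_mono)
      show "(norm (C x))\<^sup>2 \<le> c\<^sup>2 * (norm x)\<^sup>2" for x
        unfolding power_mult_distrib[symmetric]
        by (rule power_mono[OF clinear_norm_leD(4)[OF C]]) simp
    qed simp
    also have "\<dots> \<le> a\<^sup>2 * b\<^sup>2 * (c\<^sup>2 * (norm v)\<^sup>2)"
      unfolding sum_distrib_left[symmetric]
      using F by (intro mult_left_mono eigenprojection_Bessel_cnj) auto
    finally show "(norm (\<Sum>p\<in>F \<times> F. ?E (fst p) (A (?T (fst p) (snd p) v))))\<^sup>2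
        \<le> (a * b * c * norm v)\<^sup>2"
      by (simp add: power_mult_distrib mult.assoc)
  qed
  then show ?thesis
    unfolding spectral_crossed_def[abs_def] by (simp add: sum.cartesian_product')
qed

text \<open>The rightmost projection acts on \<open>v\<close> and collapses one sum to the index
  \<open>cnj w\<close>, leaving a diagonal sum over the other.\<close>

lemma spectral_crossed_eigen:
  assumes F: "finite F" "\<And>z. z \<in> F \<Longrightarrow> cmod z = 1"
    and A: "clinear_norm_le a A" and B: "clinear_norm_le b B" and C: "clinear_norm_le c C"
    and v: "v \<in> eigenspace U w"
  shows "spectral_crossed F A B C v =
    spectral_diagonal F (\<lambda>x. A (truncated_eigenprojection F w (B x))) (C v)"
proof -
  let ?E = "eigenprojection U"
  have "(\<Sum>w'\<in>F. ?E z (A (?E w' (B (?E (cnj z) (C (?E (cnj w') v))))))) =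
      ?E z (A (truncated_eigenprojection F w (B (?E (cnj z) (C v)))))" if z: "z \<in> F" for z
  proof -
    have "?E z (A (?E w' (B (?E (cnj z) (C (?E (cnj w') v)))))) =
       (if w' = cnj w then ?E z (A (?E (cnj w) (B (?E (cnj z) (C v))))) else 0)"
      if "w' \<in> F" for w'
      using F(2)[OF that] F(2)[OF z] eigenprojection_eigen[OF _ v, of "cnj w'"]
      by (auto simp: clinear_norm_le_zero[OF A] clinear_norm_le_zero[OF B]
          clinear_norm_le_zero[OF C] clinear_norm_le_zero[OF mean_ergodic(2)])
    then have "(\<Sum>w'\<in>F. ?E z (A (?E w' (B (?E (cnj z) (C (?E (cnj w') v))))))) =
       (\<Sum>w'\<in>F. if w' = cnj w then ?E z (A (?E (cnj w) (B (?E (cnj z) (C v))))) else 0)"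
      by (intro sum.cong) auto
    then show ?thesis
      using F(1) F(2)[OF z] clinear_norm_le_zero[OF mean_ergodic(2)]
      by (simp add: truncated_eigenprojection_def clinear_norm_le_zero[OF A])
  qed
  then show ?thesis
    unfolding spectral_crossed_def spectral_diagonal_def by (intro sum.cong) auto
qed

lemma eventually_finite_unimodular:
  "\<forall>\<^sub>F F in finite_subsets_at_top (sigma_pp_a U). finite F \<and> (\<forall>z\<in>F. cmod z = 1)"
  by (rule eventually_finite_subsets_at_top_weakI) (auto simp: sigma_pp_a_def sigma_pp_def)

text \<open>Either \<open>cnj w\<close> is an index and every \<open>F\<close> containing it gives
  the exact projection, or \<open>cnj w\<close> is not an eigenvalue and both sides vanish.\<close>

lemma truncated_eigenprojection_tendsto:
  assumes w: "w \<in> sigma_pp U"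
  shows "((\<lambda>F. truncated_eigenprojection F w u) \<longlongrightarrow> eigenprojection U (cnj w) u)
    (finite_subsets_at_top (sigma_pp_a U))"
proof (rule tendsto_eventually)
  have cw: "cmod (cnj w) = 1" using norm_sigma_pp[OF w] by simp
  note ww = cnj_mult_self_if_unimodular[OF norm_sigma_pp[OF w]]
  show "\<forall>\<^sub>F F in finite_subsets_at_top (sigma_pp_a U).
      truncated_eigenprojection F w u = eigenprojection U (cnj w) u"
  proof (cases "cnj w \<in> sigma_pp_a U")
    case True
    then have "\<forall>\<^sub>F F in finite_subsets_at_top (sigma_pp_a U). {cnj w} \<subseteq> F"
      unfolding eventually_finite_subsets_at_top by (intro exI[of _ "{cnj w}"]) auto
    then show ?thesis
      by (rule eventually_mono) (simp add: truncated_eigenprojection_def)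
  next
    case False
    \<comment> \<open>Since \<open>cnj w * w = 1\<close>, membership of \<open>cnj w\<close> in
      \<open>sigma_pp U\<close> would place it in \<open>sigma_pp_a U\<close>.\<close>
    then have "cnj w \<notin> sigma_pp U"
      using w ww unfolding sigma_pp_a_def by blast
    then have "eigenprojection U (cnj w) u = 0"
      using mean_ergodic(3)[OF cw, of u] cw unfolding sigma_pp_def by blast
    then show ?thesis by (simp add: truncated_eigenprojection_def)
  qed
qed

lemma averaging_scheme_spectral:
  "averaging_scheme U (finite_subsets_at_top (sigma_pp_a U))
     spectral_diagonal truncated_eigenprojection spectral_crossed"
proof unfold_locales
  show "\<forall>\<^sub>F F in finite_subsets_at_top (sigma_pp_a U).
      \<forall>K D. clinear_norm_le K D \<longrightarrow> clinear_norm_le K (spectral_diagonal F D)"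
    using eventually_finite_unimodular
    by (rule eventually_mono) (blast intro: clinear_norm_le_spectral_diagonal)
  show "\<forall>\<^sub>F F in finite_subsets_at_top (sigma_pp_a U). \<forall>K D w v. clinear_norm_le K D \<longrightarrow>
      w \<in> sigma_pp U \<longrightarrow> v \<in> eigenspace U w \<longrightarrow>
      spectral_diagonal F D v = truncated_eigenprojection F w (D v)"
    using eventually_finite_unimodular
    by (rule eventually_mono) (blast intro: spectral_diagonal_eigen)
next
  fix w assume w: "w \<in> sigma_pp U"
  have "clinear_norm_le 1 (truncated_eigenprojection F w)" for F
    using mean_ergodic(2)[of "cnj w"] norm_sigma_pp[OF w]
    by (cases "cnj w \<in> F") (auto simp: truncated_eigenprojection_def[abs_def] intro: clinear_norm_leI)
  then show "\<forall>\<^sub>F F in finite_subsets_at_top (sigma_pp_a U).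
      clinear_norm_le 1 (truncated_eigenprojection F w)" by simp
  show "((\<lambda>F. truncated_eigenprojection F w u) \<longlongrightarrow> eigenprojection U (cnj w) u)
      (finite_subsets_at_top (sigma_pp_a U))" for u
    by (rule truncated_eigenprojection_tendsto[OF w])
next
  fix a b c and A B C :: "'a \<Rightarrow> 'a"
  assume h: "clinear_norm_le a A" "clinear_norm_le b B" "clinear_norm_le c C"
  show "\<forall>\<^sub>F F in finite_subsets_at_top (sigma_pp_a U).
      clinear_norm_le (a * b * c) (spectral_crossed F A B C)"
    using eventually_finite_unimodular
    by (rule eventually_mono) (blast intro: clinear_norm_le_spectral_crossed h)
  show "\<forall>\<^sub>F F in finite_subsets_at_top (sigma_pp_a U). spectral_crossed F A B C v =
      spectral_diagonal F (\<lambda>x. A (truncated_eigenprojection F w (B x))) (C v)"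
    if "v \<in> eigenspace U w" for w v
    using eventually_finite_unimodular
    by (rule eventually_mono) (blast intro: spectral_crossed_eigen h that)
qed

end

section \<open>Weak limits for pair partitions\<close>

text \<open>The eventual equality accommodates rewritings of the spectral sums that rely on
  \<open>F\<close> consisting of unimodular numbers.\<close>

lemma limitin_weak_operator_if_strong:
  assumes "\<forall>\<^sub>F i in F. clinear_norm_le K (T i)" "clinear_norm_le K' L"
    and "\<And>v. ((\<lambda>i. T i v) \<longlongrightarrow> L v) F" and "\<forall>\<^sub>F i in F. T' i = T i"
  shows "limitin weak_operator_topology T' L F"
  unfolding limitin_weak_operator_topology
proof (intro conjI allI)
  show "bounded_clinear L" using assms(2) bounded_clinear_iff by blast
  show "\<forall>\<^sub>F i in F. bounded_clinear (T' i)"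
    using assms(1,4) by eventually_elim (auto simp: bounded_clinear_iff)
  fix x y
  have "((\<lambda>i. cinner x (T i y)) \<longlongrightarrow> cinner x (L y)) F"
    by (rule tendsto_cinner[OF assms(3)])
  moreover have "\<forall>\<^sub>F i in F. cinner x (T i y) = cinner x (T' i y)"
    using assms(4) by eventually_elim simp
  ultimately show "((\<lambda>i. cinner x (T' i y)) \<longlongrightarrow> cinner x (L y)) F"
    by (simp add: tendsto_cong)
qed

text \<open>Needed to evaluate the definite description in \<open>S_op\<close>: the vector
  \<open>L y - L' y\<close> is orthogonal to itself.\<close>

lemma limitin_weak_operator_unique:
  fixes T :: "'i \<Rightarrow> 'a::complex_inner \<Rightarrow> 'a"
  assumes "F \<noteq> bot" "limitin weak_operator_topology T L F" "limitin weak_operator_topology T L' F"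
  shows "L = L'"
proof
  fix y
  have eq: "cinner x (L y) = cinner x (L' y)" for x
    using assms tendsto_unique unfolding limitin_weak_operator_topology by blast
  have "cinner (L y - L' y) (L y - L' y + L' y) =
      cinner (L y - L' y) (L y - L' y) + cinner (L y - L' y) (L' y)"
    by (rule cinner_add_right)
  then have "cinner (L y - L' y) (L y - L' y) = 0"
    using eq[of "L y - L' y"] by simp
  from cinner_eq_zero[OF this] show "L y = L' y" by simp
qed

lemma pair_partition_cases:
  assumes "pair_partition \<alpha>"
  shows "(\<alpha> 1, \<alpha> 2, \<alpha> 3, \<alpha> 4) \<in>
    {(1,1,2,2), (2,2,1,1), (1,2,1,2), (2,1,2,1), (1,2,2,1), (2,1,1,2)}"
proof -
  have I: "{1..4} = {1, 2, 3, 4::nat}" by auto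
  have r: "\<alpha> p \<in> {1, 2}" if "p \<in> {1, 2, 3, 4}" for p
    using assms that unfolding pair_partition_def I by blast
  \<comment> \<open>Block size as a sum of indicators: of the sixteen assignments of the values 1
    and 2, exactly six pass this count.\<close>
  have "(\<Sum>p\<in>{1, 2, 3, 4}. if \<alpha> p = 1 then 1 else 0) = (2::nat)"
    using assms unfolding pair_partition_def I
    by (simp only: card_eq_sum sum.inter_filter finite.intros ball_simps)
  then show ?thesis
    using r[of 1] r[of 2] r[of 3] r[of 4] by auto
qed

text \<open>A position is the minimum of its block exactly when no earlier position carries the same
  label.\<close>

lemma sharp_eq:
  "sharp \<alpha> z 1 = z (\<alpha> 1)"
  "sharp \<alpha> z 2 = (if \<alpha> 1 = \<alpha> 2 then cnj (z (\<alpha> 2)) else z (\<alpha> 2))"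
  "sharp \<alpha> z 3 = (if \<alpha> 1 = \<alpha> 3 \<or> \<alpha> 2 = \<alpha> 3 then cnj (z (\<alpha> 3)) else z (\<alpha> 3))"
  "sharp \<alpha> z 4 = (if \<alpha> 1 = \<alpha> 4 \<or> \<alpha> 2 = \<alpha> 4 \<or> \<alpha> 3 = \<alpha> 4 then cnj (z (\<alpha> 4)) else z (\<alpha> 4))"
proof -
  have Min: "p = Min {q \<in> {1..4}. \<alpha> q = \<alpha> p} \<longleftrightarrow> (\<forall>q\<in>{1..4}. \<alpha> q = \<alpha> p \<longrightarrow> p \<le> q)"
    if "p \<in> {1..4}" for p
    using that by (subst eq_commute, subst Min_eq_iff) auto
  have I: "{1..4} = {1, 2, 3, 4::nat}" by auto
  show
    "sharp \<alpha> z 1 = z (\<alpha> 1)"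
    "sharp \<alpha> z 2 = (if \<alpha> 1 = \<alpha> 2 then cnj (z (\<alpha> 2)) else z (\<alpha> 2))"
    "sharp \<alpha> z 3 = (if \<alpha> 1 = \<alpha> 3 \<or> \<alpha> 2 = \<alpha> 3 then cnj (z (\<alpha> 3)) else z (\<alpha> 3))"
    "sharp \<alpha> z 4 = (if \<alpha> 1 = \<alpha> 4 \<or> \<alpha> 2 = \<alpha> 4 \<or> \<alpha> 3 = \<alpha> 4 then cnj (z (\<alpha> 4)) else z (\<alpha> 4))"
    using Min[of 1] Min[of 2] Min[of 3] Min[of 4] unfolding sharp_def I by auto
qed

section \<open>Weak operator limits in an averaging scheme\<close>

context averaging_scheme
begin

lemma adjacent_weak_limit:
  assumes h: "clinear_norm_le a A" "clinear_norm_le b B" "clinear_norm_le c C"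
    and "\<forall>\<^sub>F i in \<F>. T i = (\<lambda>v. Q i A (B (Q i C v)))"
  shows "limitin weak_operator_topology T (\<lambda>v. diagonal_limit A (B (diagonal_limit C v))) \<F>"
proof (rule limitin_weak_operator_if_strong[OF _ _ adjacent_tendsto[OF h] assms(4)])
  show "\<forall>\<^sub>F i in \<F>. clinear_norm_le (a * (b * c)) (\<lambda>v. Q i A (B (Q i C v)))"
    using Q_bound
  proof eventually_elim
    case (elim i)
    then have "clinear_norm_le a (Q i A)" "clinear_norm_le c (Q i C)" using h by blast+
    then show ?case by (intro clinear_norm_le_comp[OF _ clinear_norm_le_comp] h)
  qed
  show "clinear_norm_le (a * (b * c)) (\<lambda>v. diagonal_limit A (B (diagonal_limit C v)))"
    by (rule clinear_norm_le_comp[OF diagonal_limit(1)[OF h(1)]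
          clinear_norm_le_comp[OF h(2) diagonal_limit(1)[OF h(3)]]])
qed

lemma nested_weak_limit:
  assumes h: "clinear_norm_le a A" "clinear_norm_le b B" "clinear_norm_le c C"
    and "\<forall>\<^sub>F i in \<F>. T i = Q i (\<lambda>x. A (Q i B (C x)))"
  shows "limitin weak_operator_topology T (diagonal_limit (\<lambda>x. A (diagonal_limit B (C x)))) \<F>"
proof (rule limitin_weak_operator_if_strong[OF _ _ nested_tendsto[OF h] assms(4)])
  show "\<forall>\<^sub>F i in \<F>. clinear_norm_le (a * (b * c)) (Q i (\<lambda>x. A (Q i B (C x))))"
    using Q_bound
  proof eventually_elim
    case (elim i)
    then have "clinear_norm_le (a * (b * c)) (\<lambda>x. A (Q i B (C x)))"
      using h by (intro clinear_norm_le_comp[OF h(1) clinear_norm_le_comp[OF _ h(3)]]) blast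
    with elim show ?case by blast
  qed
  show "clinear_norm_le (a * (b * c)) (diagonal_limit (\<lambda>x. A (diagonal_limit B (C x))))"
    by (rule diagonal_limit(1)[OF clinear_norm_le_comp[OF h(1)
            clinear_norm_le_comp[OF diagonal_limit(1)[OF h(2)] h(3)]]])
qed

lemma crossed_weak_limit:
  assumes h: "clinear_norm_le a A" "clinear_norm_le b B" "clinear_norm_le c C"
    and "\<forall>\<^sub>F i in \<F>. T i = R i A B C"
  shows "limitin weak_operator_topology T (crossed_limit A B C) \<F>"
  by (rule limitin_weak_operator_if_strong[OF R_bound[OF h] crossed_limit(1)[OF h]
        crossed_tendsto[OF h] assms(4)])

end

section \<open>Identification of the three types of pair partition\<close>

context almost_periodic_unitary
begin

lemma adjacent_average_eq:
  assumes A: "clinear_norm_le a A" and B: "clinear_norm_le b B"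
  shows "(1 / (real N)\<^sup>2) *\<^sub>R
      (\<Sum>n<N. \<Sum>m<N. (U ^^ n) (A ((U ^^ n) (B ((U ^^ m) (C ((U ^^ m) v))))))) =
    diagonal_average N A (B (diagonal_average N C v))"
  by (simp add: diagonal_average_def clinear_norm_le_scaleR[OF A] clinear_norm_le_scaleR[OF B]
      clinear_norm_le_scaleR[OF clinear_norm_le_funpow] clinear_norm_le_sum[OF A]
      clinear_norm_le_sum[OF B] clinear_norm_le_sum[OF clinear_norm_le_funpow]
      scaleR_sum_right power2_eq_square)

lemma nested_average_eq:
  assumes A: "clinear_norm_le a A"
  shows "(1 / (real N)\<^sup>2) *\<^sub>R
      (\<Sum>n<N. \<Sum>m<N. (U ^^ n) (A ((U ^^ m) (B ((U ^^ m) (C ((U ^^ n) v))))))) =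
    diagonal_average N (\<lambda>x. A (diagonal_average N B (C x))) v"
  by (simp add: diagonal_average_def clinear_norm_le_scaleR[OF A]
      clinear_norm_le_scaleR[OF clinear_norm_le_funpow] clinear_norm_le_sum[OF A]
      clinear_norm_le_sum[OF clinear_norm_le_funpow] scaleR_sum_right power2_eq_square)

lemma crossed_average_eq:
  "(1 / (real N)\<^sup>2) *\<^sub>R
      (\<Sum>n<N. \<Sum>m<N. (U ^^ n) (A ((U ^^ m) (B ((U ^^ n) (C ((U ^^ m) v))))))) =
    crossed_average N A B C v"
  by (simp add: crossed_average_def scaleR_sum_right power2_eq_square)

lemma adjacent_spectral_eq:
  assumes F: "\<And>z. z \<in> F \<Longrightarrow> cmod z = 1"
    and A: "clinear_norm_le a A" and B: "clinear_norm_le b B"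
  shows "(\<Sum>z\<in>F. \<Sum>w\<in>F. eigenprojection U z (A (eigenprojection U (cnj z)
      (B (eigenprojection U w (C (eigenprojection U (cnj w) v))))))) =
    spectral_diagonal F A (B (spectral_diagonal F C v))"
  unfolding spectral_diagonal_def
  by (intro sum.cong refl)
    (simp add: F clinear_norm_le_sum[OF A] clinear_norm_le_sum[OF B]
      clinear_norm_le_sum[OF mean_ergodic(2)])

lemma nested_spectral_eq:
  assumes F: "\<And>z. z \<in> F \<Longrightarrow> cmod z = 1" and A: "clinear_norm_le a A"
  shows "(\<Sum>z\<in>F. \<Sum>w\<in>F. eigenprojection U z (A (eigenprojection U w
      (B (eigenprojection U (cnj w) (C (eigenprojection U (cnj z) v))))))) =
    spectral_diagonal F (\<lambda>x. A (spectral_diagonal F B (C x))) v"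
  unfolding spectral_diagonal_def
  by (intro sum.cong refl)
    (simp add: F clinear_norm_le_sum[OF A] clinear_norm_le_sum[OF mean_ergodic(2)])

interpretation avg: averaging_scheme U sequentially diagonal_average twisted_average crossed_average
  by (rule averaging_scheme_averages)

interpretation spec: averaging_scheme U "finite_subsets_at_top (sigma_pp_a U)"
  spectral_diagonal truncated_eigenprojection spectral_crossed
  by (rule averaging_scheme_spectral)

text \<open>Up to exchanging the two labels there are three partitions: adjacent, crossed and
  nested. In each, both schemes lead to the same expression in \<open>diagonal_limit\<close> or
  \<open>crossed_limit\<close>.\<close>

lemma common_weak_limit:
  assumes A: "clinear_norm_le a A" and B: "clinear_norm_le b B" and C: "clinear_norm_le c C"
    and \<alpha>: "pair_partition \<alpha>"
  shows "\<exists>L. limitin weak_operator_topology (S_partial U \<alpha> A B C) L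
      (finite_subsets_at_top (sigma_pp_a U)) \<and>
    limitin weak_operator_topology (entangled_average U \<alpha> A B C) L sequentially"
proof -
  note defs = S_partial_def entangled_average_def choose2_def sharp_eq[unfolded One_nat_def]
    Let_def o_def
  consider "(\<alpha> 1, \<alpha> 2, \<alpha> 3, \<alpha> 4) \<in> {(1,1,2,2), (2,2,1,1)}"
    | "(\<alpha> 1, \<alpha> 2, \<alpha> 3, \<alpha> 4) \<in> {(1,2,1,2), (2,1,2,1)}"
    | "(\<alpha> 1, \<alpha> 2, \<alpha> 3, \<alpha> 4) \<in> {(1,2,2,1), (2,1,1,2)}"
    using pair_partition_cases[OF \<alpha>] by auto
  then show ?thesis
  proof cases
    case 1
    have "S_partial U \<alpha> A B C F v = (\<Sum>z\<in>F. \<Sum>w\<in>F. eigenprojection U z (A (eigenprojection U (cnj z)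
        (B (eigenprojection U w (C (eigenprojection U (cnj w) v)))))))" for F v
      \<comment> \<open>The labelling 1122 matches term by term; for 2211 the two summation
        variables trade places. The other types are treated likewise.\<close>
      using 1 by (auto simp: defs) (rule sum.swap)
    then have S: "\<forall>\<^sub>F F in finite_subsets_at_top (sigma_pp_a U). S_partial U \<alpha> A B C F =
        (\<lambda>v. spectral_diagonal F A (B (spectral_diagonal F C v)))"
      using eventually_finite_unimodular by (auto elim!: eventually_mono simp: adjacent_spectral_eq[OF _ A B])
    have "entangled_average U \<alpha> A B C N v = (1 / (real N)\<^sup>2) *\<^sub>R
      (\<Sum>n<N. \<Sum>m<N. (U ^^ n) (A ((U ^^ n) (B ((U ^^ m) (C ((U ^^ m) v)))))))" for N v
      using 1 by (auto simp: defs) (rule sum.swap)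
    then have "\<forall>\<^sub>F N in sequentially. entangled_average U \<alpha> A B C N =
        (\<lambda>v. diagonal_average N A (B (diagonal_average N C v)))"
      by (intro always_eventually allI ext) (simp only: adjacent_average_eq[OF A B])
    with S show ?thesis
      using avg.adjacent_weak_limit[OF A B C] spec.adjacent_weak_limit[OF A B C] by blast
  next
    case 2
    have "S_partial U \<alpha> A B C F v = spectral_crossed F A B C v" for F v
      using 2 unfolding spectral_crossed_def by (auto simp: defs) (rule sum.swap)
    then have S: "\<forall>\<^sub>F F in finite_subsets_at_top (sigma_pp_a U). S_partial U \<alpha> A B C F =
        spectral_crossed F A B C"
      by (intro always_eventually allI ext)
    have "entangled_average U \<alpha> A B C N v = (1 / (real N)\<^sup>2) *\<^sub>R
      (\<Sum>n<N. \<Sum>m<N. (U ^^ n) (A ((U ^^ m) (B ((U ^^ n) (C ((U ^^ m) v)))))))" for N v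
      using 2 by (auto simp: defs) (rule sum.swap)
    then have "\<forall>\<^sub>F N in sequentially. entangled_average U \<alpha> A B C N = crossed_average N A B C"
      by (intro always_eventually allI ext) (simp only: crossed_average_eq)
    with S show ?thesis
      using avg.crossed_weak_limit[OF A B C] spec.crossed_weak_limit[OF A B C] by blast
  next
    case 3
    have "S_partial U \<alpha> A B C F v = (\<Sum>z\<in>F. \<Sum>w\<in>F. eigenprojection U z (A (eigenprojection U w
        (B (eigenprojection U (cnj w) (C (eigenprojection U (cnj z) v)))))))" for F v
      using 3 by (auto simp: defs) (rule sum.swap)
    then have S: "\<forall>\<^sub>F F in finite_subsets_at_top (sigma_pp_a U). S_partial U \<alpha> A B C F =
        spectral_diagonal F (\<lambda>x. A (spectral_diagonal F B (C x)))"
      using eventually_finite_unimodular by (auto elim!: eventually_mono simp: nested_spectral_eq[OF _ A])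
    have "entangled_average U \<alpha> A B C N v = (1 / (real N)\<^sup>2) *\<^sub>R
      (\<Sum>n<N. \<Sum>m<N. (U ^^ n) (A ((U ^^ m) (B ((U ^^ m) (C ((U ^^ n) v)))))))" for N v
      using 3 by (auto simp: defs) (rule sum.swap)
    then have "\<forall>\<^sub>F N in sequentially. entangled_average U \<alpha> A B C N =
        diagonal_average N (\<lambda>x. A (diagonal_average N B (C x)))"
      by (intro always_eventually allI ext) (simp only: nested_average_eq[OF A])
    with S show ?thesis
      using avg.nested_weak_limit[OF A B C] spec.nested_weak_limit[OF A B C] by blast
  qed
qed

end

theorem theorem3p2:
  fixes U A B C :: "'a::complex_hilbert_space \<Rightarrow> 'a"
    and \<alpha> :: "nat \<Rightarrow> nat"
  assumes "unitary_op U"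
    and "almost_periodic U"
    and "pair_partition \<alpha>"
    and "bounded_clinear A" and "bounded_clinear B" and "bounded_clinear C"
  shows "limitin weak_operator_topology (S_partial U \<alpha> A B C) (S_op U \<alpha> A B C)
           (finite_subsets_at_top (sigma_pp_a U)) \<and>
         limitin weak_operator_topology (entangled_average U \<alpha> A B C) (S_op U \<alpha> A B C)
           sequentially"
proof -
  interpret almost_periodic_unitary U
    using assms(1,2) by unfold_locales
  obtain L where L: "limitin weak_operator_topology (S_partial U \<alpha> A B C) L
      (finite_subsets_at_top (sigma_pp_a U))"
    "limitin weak_operator_topology (entangled_average U \<alpha> A B C) L sequentially"
    using assms(3-6) common_weak_limit unfolding bounded_clinear_iff by metis
  \<comment> \<open>The filter of finite subsets is proper, so weak limits along it are unique and
    the definite description equals \<open>L\<close>.\<close>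
  have "S_op U \<alpha> A B C = L"
    unfolding S_op_def
    using L(1) limitin_weak_operator_unique[OF finite_subsets_at_top_neq_bot]
    by (blast intro: the_equality)
  with L show ?thesis by simp
qed

end
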